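(* Let $k>1$ be a fixed integer, and let the parameters $\alpha,\beta\in[0,\infty)$ satisfy $(\alpha,\beta)\neq(0,0)$ (infinite parameters are also allowed, by limits, as described in the context). Let $B_n^{(k)}$ be the number of symbols $\beta$ on the $k$-th diagonal of a random weighted staircase tableau of size $n$, i.e. a random $\alpha/\beta$-staircase tableau of size $n$ distributed according to $\mathbb{P}_{n,\alpha,\beta}$. Then, as $n\to\infty$, $$B_n^{(k)}\ \stackrel{d}{\longrightarrow}\ \mathrm{Pois}\left(\tfrac12\right),$$ where $\mathrm{Pois}(\lambda)$ denotes the Poisson distribution with parameter $\lambda$ and $\stackrel{d}{\to}$ is convergence in distribution.
   Context: An $\alpha/\beta$-staircase tableau of size $n$ is a Young diagram of shape $(n,n-1,\dots,1)$ (rows and columns numbered from the NW corner; box $(i,j)$ is in row $i$, column $j$, with $i,j\ge1$, $i+j\le n+1$) whose boxes are each either empty or filled with one symbol $\alpha$ or $\beta$, such that: (1) every box with $i+j=n+1$ (the first diagonal) contains a symbol; (2) all boxes in the same column as and north of (above) an $\alpha$ are empty; (3) all boxes in the same row as and west of (to the left of) a $\beta$ are empty. $\mathcal{S}_n$ is the set of all such tableaux. For $1\le k\le n$, the $k$-th diagonal is the set of boxes $(i,j)$ with $i+j=n-k+2$; it has $n-k+1$ boxes. The letters $\alpha,\beta$ are also used as numerical weights. For $n\ge1$ and $\alpha,\beta\in[0,\infty)$ with $(\alpha,\beta)\neq(0,0)$, the weight $wt(S)$ of $S\in\mathcal{S}_n$ is the product of all its symbols, i.e. $\alpha^{\#\alpha(S)}\beta^{\#\beta(S)}$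 (with $0^0=1$), where $\#\alpha(S)$ and $\#\beta(S)$ are the numbers of $\alpha$'s and $\beta$'s in $S$, and $\mathbb{P}_{n,\alpha,\beta}(S)=wt(S)/Z_n(\alpha,\beta)$ with $Z_n(\alpha,\beta)=\sum_{S\in\mathcal{S}_n}wt(S)$. Infinite parameters are allowed by taking limits of $\mathbb{P}_{n,\alpha,\beta}$: $\alpha\to\infty$ with $\beta$ fixed, $\beta\to\infty$ with $\alpha$ fixed, or $\alpha=\beta\to\infty$.
   Formalization: The parameters are required to satisfy α>0 and β>0 (each possibly infinite) instead of (α,β)≠(0,0): if α=0 or β=0, all symbols lie on the first diagonal, so B_n^{(k)}=0 for k>1 and the Poisson limit fails. *)

theory Defs
  imports "HOL-Probability.Probability"
begin

datatype symbol = Alpha | Beta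

text \<open>A filling assigns to the box in row \<open>i\<close> and column \<open>j\<close> its symbol, or \<open>None\<close> if it is
  empty; outside the diagram a tableau has value \<open>None\<close>, so that distinct functions are distinct
  tableaux.\<close>

type_synonym tableau = "nat \<times> nat \<Rightarrow> symbol option"

definition boxes :: "nat \<Rightarrow> (nat \<times> nat) set" where
  "boxes n = {(i, j). 1 \<le> i \<and> 1 \<le> j \<and> i + j \<le> n + 1}"

definition staircase_tableaux :: "nat \<Rightarrow> tableau set" where
  "staircase_tableaux n = {S.
     (\<forall>x. x \<notin> boxes n \<longrightarrow> S x = None) \<and>
     (\<forall>i j. (i, j) \<in> boxes n \<longrightarrow> i + j = n + 1 \<longrightarrow> S (i, j) \<noteq> None) \<and>
     (\<forall>i j i'. S (i, j) = Some Alpha \<longrightarrow> i' < i \<longrightarrow> S (i', j) = None) \<and>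
     (\<forall>i j j'. S (i, j) = Some Beta \<longrightarrow> j' < j \<longrightarrow> S (i, j') = None)}"

text \<open>The equation \<open>i + j = n - k + 2\<close>, without truncated subtraction.\<close>

definition diagonal :: "nat \<Rightarrow> nat \<Rightarrow> (nat \<times> nat) set" where
  "diagonal n k = {(i, j) \<in> boxes n. i + j + k = n + 2}"

definition num_symbol :: "symbol \<Rightarrow> tableau \<Rightarrow> nat" where
  "num_symbol s S = card {x. S x = Some s}"

definition beta_count :: "nat \<Rightarrow> nat \<Rightarrow> tableau \<Rightarrow> nat" where
  "beta_count n k S = card {x \<in> diagonal n k. S x = Some Beta}"

definition weight :: "real \<Rightarrow> real \<Rightarrow> tableau \<Rightarrow> real" where
  "weight a b S = a ^ num_symbol Alpha S * b ^ num_symbol Beta S"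

definition partition_function :: "nat \<Rightarrow> real \<Rightarrow> real \<Rightarrow> real" where
  "partition_function n a b = (\<Sum>S\<in>staircase_tableaux n. weight a b S)"

definition finite_prob :: "nat \<Rightarrow> real \<Rightarrow> real \<Rightarrow> tableau \<Rightarrow> real" where
  "finite_prob n a b S = (if S \<in> staircase_tableaux n then weight a b S / partition_function n a b else 0)"

text \<open>Parameters in \<open>[0, \<infinity>]\<close>, where \<open>top\<close> is infinity. If both parameters are infinite, they
  tend to infinity along the line where they are equal.\<close>

definition tableau_prob :: "nat \<Rightarrow> ennreal \<Rightarrow> ennreal \<Rightarrow> tableau \<Rightarrow> real" where
  "tableau_prob n \<alpha> \<beta> S =
    (if \<alpha> = top \<and> \<beta> = top then Lim at_top (\<lambda>t. finite_prob n t t S)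
     else if \<alpha> = top then Lim at_top (\<lambda>t. finite_prob n t (enn2real \<beta>) S)
     else if \<beta> = top then Lim at_top (\<lambda>t. finite_prob n (enn2real \<alpha>) t S)
     else finite_prob n (enn2real \<alpha>) (enn2real \<beta>) S)"

definition tableau_pmf :: "nat \<Rightarrow> ennreal \<Rightarrow> ennreal \<Rightarrow> tableau pmf" where
  "tableau_pmf n \<alpha> \<beta> = embed_pmf (tableau_prob n \<alpha> \<beta>)"

lemma finite_boxes: "finite (boxes n)"
  by (rule finite_subset[of _ "{..n+1} \<times> {..n+1}"]) (auto simp: boxes_def)

lemma finite_staircase_tableaux: "finite (staircase_tableaux n)"
proof (rule finite_subset)
  let ?F = "{f. \<forall>x. (x \<in> boxes n \<longrightarrow> f x \<in> {None, Some Alpha, Some Beta}) \<and> (x \<notin> boxes n \<longrightarrow> f x = None)}"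
  have symbols: "v \<in> {None, Some Alpha, Some Beta}" for v :: "symbol option"
  proof (cases v)
    case (Some s)
    then show ?thesis by (cases s) simp_all
  qed simp
  show "staircase_tableaux n \<subseteq> ?F"
    using symbols by (simp add: staircase_tableaux_def subset_iff)
  show "finite ?F"
    by (intro finite_set_of_finite_funs finite_boxes) simp
qed

lemma partition_function_pos:
  assumes "0 \<le> a" "0 \<le> b" "(a, b) \<noteq> (0, 0)"
  shows "0 < partition_function n a b"
proof -
  define T where "T s = (\<lambda>(i::nat, j::nat). if 1 \<le> i \<and> 1 \<le> j \<and> i + j = n + 1 then Some s else None)"
    for s :: symbol
  have T: "T s \<in> staircase_tableaux n" for s
    by (auto simp: T_def staircase_tableaux_def boxes_def split: if_splits)
  have "\<exists>S\<in>staircase_tableaux n. 0 < weight a b S"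
  proof (cases "a = 0")
    case True
    have "{x. T Beta x = Some Alpha} = {}"
      by (auto simp: T_def split: if_splits)
    then have "num_symbol Alpha (T Beta) = 0"
      by (simp only: num_symbol_def card.empty)
    then show ?thesis using assms True
      by (intro bexI[OF _ T[of Beta]]) (auto simp: weight_def)
  next
    case False
    have "{x. T Alpha x = Some Beta} = {}"
      by (auto simp: T_def split: if_splits)
    then have "num_symbol Beta (T Alpha) = 0"
      by (simp only: num_symbol_def card.empty)
    then show ?thesis using assms False
      by (intro bexI[OF _ T[of Alpha]]) (auto simp: weight_def)
  qed
  then show ?thesis unfolding partition_function_def
    using assms finite_staircase_tableaux by (auto intro!: sum_pos2 simp: weight_def)
qed

lemma pmf_tableau_pmf_finite:
  assumes "0 \<le> a" "0 \<le> b" "(a, b) \<noteq> (0, 0)"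
  shows "pmf (tableau_pmf n (ennreal a) (ennreal b)) S = finite_prob n a b S"
proof -
  have nn: "0 \<le> finite_prob n a b S" for S
    using assms partition_function_pos[OF assms, of n] by (auto simp: finite_prob_def weight_def)
  have "(\<integral>\<^sup>+ S. ennreal (finite_prob n a b S) \<partial>count_space UNIV) =
      (\<Sum>S\<in>staircase_tableaux n. ennreal (finite_prob n a b S))"
    by (rule nn_integral_count_space') (auto simp: finite_staircase_tableaux finite_prob_def)
  also have "\<dots> = ennreal (\<Sum>S\<in>staircase_tableaux n. finite_prob n a b S)"
    using nn by (simp add: sum_ennreal)
  also have "(\<Sum>S\<in>staircase_tableaux n. finite_prob n a b S) = 1"
    using partition_function_pos[OF assms, of n]
    by (simp add: finite_prob_def sum_divide_distrib[symmetric] partition_function_def[symmetric])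
  finally have "(\<integral>\<^sup>+ S. ennreal (finite_prob n a b S) \<partial>count_space UNIV) = 1" by simp
  moreover have "tableau_prob n (ennreal a) (ennreal b) = finite_prob n a b"
    using assms by (auto simp: tableau_prob_def)
  ultimately show ?thesis
    using nn by (simp add: tableau_pmf_def pmf_embed_pmf)
qed

text \<open>If one weight is zero, then only the first diagonal contains symbols, all of them equal, so
  no Poisson limit can hold on a later diagonal. The lemma gives the case \<open>\<beta> = 0\<close>.\<close>

lemma not_weak_conv_zero_weight:
  assumes "0 < a"
  shows "\<not> weak_conv_m
    (\<lambda>n. distr (measure_pmf (tableau_pmf n (ennreal a) 0)) borel (\<lambda>S. real (beta_count n k S)))
    (distr (measure_pmf (poisson_pmf (1/2))) borel real)"
proof
  let ?M = "\<lambda>n. distr (measure_pmf (tableau_pmf n (ennreal a) 0)) borel (\<lambda>S. real (beta_count n k S))"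
  let ?P = "distr (measure_pmf (poisson_pmf (1/2))) borel real"
  have P: "cdf ?P x = exp (-1/2)" if "0 \<le> x" "x < 1" for x
  proof -
    have "real -` {..x} = {0}" using that by auto
    then show ?thesis
      by (simp add: cdf_def measure_distr measure_pmf_single)
  qed
  have "isCont (cdf ?P) (1/2)"
  proof -
    have "\<forall>\<^sub>F x in nhds (1/2). cdf ?P x = exp (-1/2)"
      by (rule eventually_mono[OF eventually_nhds_in_open[of "{0<..<1}"]]) (simp_all add: P)
    then show ?thesis using isCont_cong[of "cdf ?P" "\<lambda>_. exp (-1/2)"] by simp
  qed
  moreover assume "weak_conv_m ?M ?P"
  ultimately have lim: "(\<lambda>n. cdf (?M n) (1/2)) \<longlonglongrightarrow> cdf ?P (1/2)"
    by (simp add: weak_conv_m_def weak_conv_def)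
  have "cdf (?M n) (1/2) = 1" for n
  proof -
    have "beta_count n k S = 0" if "S \<in> set_pmf (tableau_pmf n (ennreal a) 0)" for S
    proof -
      have "finite_prob n a 0 S \<noteq> 0"
        using that pmf_tableau_pmf_finite[of a 0 n S] assms by (simp add: set_pmf_iff)
      then have S: "S \<in> staircase_tableaux n" and "weight a 0 S \<noteq> 0"
        by (simp_all add: finite_prob_def split: if_split_asm)
      then have "num_symbol Beta S = 0"
        by (cases "num_symbol Beta S") (simp_all add: weight_def)
      moreover have "x \<in> boxes n" if "S x = Some Beta" for x
      proof (rule ccontr)
        assume "x \<notin> boxes n"
        with S have "S x = None" unfolding staircase_tableaux_def by blast
        with that show False by simp
      qed
      then have "{x. S x = Some Beta} \<subseteq> boxes n" by blast
      then have "finite {x. S x = Some Beta}"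
        using finite_boxes finite_subset by blast
      ultimately have "{x. S x = Some Beta} = {}"
        by (simp only: num_symbol_def card_0_eq)
      then have "{x \<in> diagonal n k. S x = Some Beta} = {}" by blast
      then show ?thesis by (simp only: beta_count_def card.empty)
    qed
    then have "measure (measure_pmf (tableau_pmf n (ennreal a) 0))
        ((\<lambda>S. real (beta_count n k S)) -` {..1/2}) = 1"
      by (subst measure_pmf.prob_eq_1) (simp_all add: AE_measure_pmf_iff)
    then show ?thesis by (simp add: cdf_def measure_distr)
  qed
  with lim P[of "1/2"] have "(1::real) = exp (-1/2)"
    by (simp add: LIMSEQ_const_iff)
  then show False by simp
qed

end

theory Submission
  imports Defs
begin

text \<open>Put \<open>a = 1/\<alpha>\<close> and \<open>b = 1/\<beta>\<close>. Removing the first row of a random tableau of size \<open>n\<close> with parameters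
  \<open>(a, b)\<close> leaves a random tableau of size \<open>n - 1\<close> with parameters \<open>(a + 1, b)\<close>. Counting the fillings of
  the first row shows that, with \<open>s = a + b + n\<close>, its box on the \<open>k\<close>-th diagonal contains \<open>\<beta>\<close> with
  probability \<open>a/s\<^sup>2 + O(1/s\<^sup>2)\<close>, and that given this event the rows further below are distributed like
  a tableau of size \<open>n - k\<close> with parameters \<open>(a + k - 2, b)\<close>, up to small errors. So the generating
  function \<open>\<phi>(n, a) = E x\<^sup>B\<close> of the number of symbols \<open>\<beta>\<close> on the \<open>k\<close>-th diagonal satisfies
  \<open>\<phi>(n, a) = \<phi>(n - 1, a + 1) + (x - 1) (a/s\<^sup>2) \<phi>(n - k, a + k - 2) + O(1/s\<^sup>2)\<close>.
  The function \<open>exp ((x - 1) (1 - (a/s)\<^sup>2) / 2)\<close> solves this recursion approximately, and an induction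
  on \<open>n\<close> bounds the difference by \<open>O(1/s)\<close>. For fixed \<open>a\<close> the limit is \<open>exp ((x - 1) / 2)\<close>, and Levy's
  continuity theorem applies.\<close>

section \<open>Removing the first row\<close>

text \<open>With u = a / s the recursion is a discrete form of f'(u) = (1 - x) u f(u), f(1) = 1,
  whose solution is the exponential above; near u = 1 the tableau is small compared with s. The two
  recursive terms have different sizes and parameters, so the induction must be uniform in all
  \<open>a >= 1\<close>, although a single \<open>a\<close> is wanted in the end. About n <= s
  errors of order 1/s^2 add up to O(1/s), provided that the term at size n - k does not amplify
  them; a factor exponential in n/s in the induction hypothesis ensures this. The bound
  \<open>a >= 1\<close> keeps 1 + 1/a at most 2. The original parameter may be smaller, even 0 for
  an infinite weight, and if both weights are infinite the normaliser vanishes. Hence one row is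
  removed before anything is estimated; this raises \<open>a\<close> by one and changes the count
  with vanishing probability. The variable x is complex with norm at most 1 because x = exp(i t)
  gives the characteristic function. Zero weights are excluded: they leave no symbols off the first
  diagonal.\<close>

lemma UNIV_symbol: "(UNIV :: symbol set) = {Alpha, Beta}"
  using symbol.exhaust by auto

text \<open>In these columns a new first row may carry symbols besides its last box, since
  everything above an \<open>Alpha\<close> must be empty.\<close>

definition free_columns :: "nat \<Rightarrow> tableau \<Rightarrow> nat set" where
  "free_columns n T = {j \<in> {1..n}. \<forall>i. T (i, j) \<noteq> Some Alpha}"

text \<open>Rows start at 1; without the case \<open>i = 0\<close> the deleted first row would
  survive as row 0.\<close>

definition drop_row :: "tableau \<Rightarrow> tableau" where
  "drop_row S = (\<lambda>(i, j). if i = 0 then None else S (Suc i, j))"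

text \<open>\<open>Suc n\<close> always belongs to the support because the last box of the new row
  lies on the first diagonal. The pairs \<open>(Y, s)\<close> range over a full product, so sums
  over the first row factor.\<close>

definition add_row :: "nat \<Rightarrow> tableau \<Rightarrow> nat set \<Rightarrow> symbol \<Rightarrow> tableau" where
  "add_row n T Y s = (\<lambda>(i, j).
     if i = 0 then None
     else if i = 1 then
       (if j \<in> insert (Suc n) Y then Some (if j = Min (insert (Suc n) Y) then s else Alpha) else None)
     else T (i - 1, j))"

lemma add_row_simps [simp]:
  "add_row n T Y s (0, j) = None"
  "add_row n T Y s (Suc 0, j) =
    (if j \<in> insert (Suc n) Y then Some (if j = Min (insert (Suc n) Y) then s else Alpha) else None)"
  "add_row n T Y s (Suc (Suc i), j) = T (Suc i, j)"
  by (simp_all add: add_row_def)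

lemma finite_free_columns [simp]: "finite (free_columns n T)"
  by (simp add: free_columns_def)

lemma staircase_outside: "S \<in> staircase_tableaux n \<Longrightarrow> x \<notin> boxes n \<Longrightarrow> S x = None"
  unfolding staircase_tableaux_def by blast

lemma staircase_diagonal:
  assumes "S \<in> staircase_tableaux n" "1 \<le> i" "1 \<le> j" "i + j = n + 1"
  shows "S (i, j) \<noteq> None"
proof -
  have "(i, j) \<in> boxes n" using assms by (simp add: boxes_def)
  then show ?thesis using assms unfolding staircase_tableaux_def by blast
qed

lemma staircase_alpha:
  "S \<in> staircase_tableaux n \<Longrightarrow> S (i, j) = Some Alpha \<Longrightarrow> i' < i \<Longrightarrow> S (i', j) = None"
  unfolding staircase_tableaux_def by blast

lemma staircase_beta:
  "S \<in> staircase_tableaux n \<Longrightarrow> S (i, j) = Some Beta \<Longrightarrow> j' < j \<Longrightarrow> S (i, j') = None"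
  unfolding staircase_tableaux_def by blast

lemma staircase_in_boxes: "S \<in> staircase_tableaux n \<Longrightarrow> S x = Some s \<Longrightarrow> x \<in> boxes n"
  using staircase_outside by fastforce

lemma finite_symbol: "S \<in> staircase_tableaux n \<Longrightarrow> finite {x. S x = Some s}"
  by (rule finite_subset[OF _ finite_boxes[of n]]) (auto dest: staircase_in_boxes)

lemma drop_row_in_staircase:
  assumes "S \<in> staircase_tableaux (Suc n)"
  shows "drop_row S \<in> staircase_tableaux n"
  unfolding staircase_tableaux_def mem_Collect_eq
proof (intro conjI allI impI)
  fix x assume "x \<notin> boxes n"
  then show "drop_row S x = None"
    using staircase_outside[OF assms, of "(Suc (fst x), snd x)"]
    by (cases x) (auto simp: drop_row_def boxes_def)
next
  fix i j assume "(i, j) \<in> boxes n" "i + j = n + 1"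
  then show "drop_row S (i, j) \<noteq> None"
    using staircase_diagonal[OF assms, of "Suc i" j] by (auto simp: drop_row_def boxes_def)
next
  fix i j i' assume "drop_row S (i, j) = Some Alpha" "i' < i"
  then show "drop_row S (i', j) = None"
    using staircase_alpha[OF assms, of "Suc i" j "Suc i'"] by (simp add: drop_row_def split: if_splits)
next
  fix i j j' assume "drop_row S (i, j) = Some Beta" "j' < j"
  then show "drop_row S (i, j') = None"
    using staircase_beta[OF assms, of "Suc i" j j'] by (simp add: drop_row_def split: if_splits)
qed

lemma add_row_in_staircase:
  assumes T: "T \<in> staircase_tableaux n" and Y: "Y \<subseteq> free_columns n T"
  shows "add_row n T Y s \<in> staircase_tableaux (Suc n)"
proof -
  let ?X = "insert (Suc n) Y"
  have fin: "finite ?X" using finite_subset[OF Y] by simp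
  have Y_le: "1 \<le> j \<and> j \<le> n \<and> T (i, j) \<noteq> Some Alpha" if "j \<in> Y" for i j
    using Y that by (auto simp: free_columns_def)
  have last: "T (i, Suc n) = None" for i
    using staircase_outside[OF T] by (cases "i = 0") (auto simp: boxes_def)
  have out: "T (i, j) = None" if "i = 0 \<or> j = 0 \<or> i + j > n + 1" for i j
    using staircase_outside[OF T] that by (auto simp: boxes_def)
  show ?thesis
    unfolding staircase_tableaux_def mem_Collect_eq
  proof (intro conjI allI impI)
    fix x assume x: "x \<notin> boxes (Suc n)"
    obtain i j where ij: "x = (i, j)" by (cases x)
    consider "i = 0" | "i = Suc 0" | i' where "i = Suc (Suc i')" by (metis not0_implies_Suc)
    then show "add_row n T Y s x = None"
    proof cases
      case 2
      with x ij have "\<not> (1 \<le> j \<and> j \<le> Suc n)" by (auto simp: boxes_def)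
      then have "j \<notin> insert (Suc n) Y" using Y_le[of j] by auto
      with 2 ij show ?thesis by simp
    next
      case (3 i')
      with x ij out show ?thesis by (auto simp: boxes_def)
    qed (simp add: ij)
  next
    fix i j assume *: "(i, j) \<in> boxes (Suc n)" "i + j = Suc n + 1"
    consider "i = Suc 0" | i' where "i = Suc (Suc i')"
    proof (cases i)
      case 0
      with *(1) show ?thesis by (simp add: boxes_def)
    next
      case (Suc l)
      then show ?thesis using that by (cases l) auto
    qed
    then show "add_row n T Y s (i, j) \<noteq> None"
      using * staircase_diagonal[OF T, of "i - 1" j] by cases (auto simp: boxes_def)
  next
    fix i j i' assume *: "add_row n T Y s (i, j) = Some Alpha" "i' < i"
    show "add_row n T Y s (i', j) = None"
    proof (cases "i' = 0")
      case False
      with *(2) obtain l where l: "i = Suc (Suc l)"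
        by (metis less_nat_zero_code not0_implies_Suc not_less_eq not_less_zero)
      with * have "T (Suc l, j) = Some Alpha" by simp
      then have "j \<notin> insert (Suc n) Y" using Y_le[of j] last by auto
      moreover have "T (i' - 1, j) = None"
        using staircase_alpha[OF T \<open>T (Suc l, j) = Some Alpha\<close>, of "i' - 1"] *(2) l by simp
      ultimately show ?thesis using False by (cases i'; cases "i' - 1") auto
    qed simp
  next
    fix i j j' assume *: "add_row n T Y s (i, j) = Some Beta" "j' < j"
    consider "i = 0" | "i = Suc 0" | i' where "i = Suc (Suc i')" by (metis not0_implies_Suc)
    then show "add_row n T Y s (i, j') = None"
    proof cases
      case 2
      with *(1) have "j = Min (insert (Suc n) Y)" by (simp split: if_splits)
      with *(2) have "j' \<notin> insert (Suc n) Y" using Min_le[OF fin, of j'] by (meson not_le)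
      with 2 show ?thesis by simp
    next
      case (3 i')
      with * show ?thesis using staircase_beta[OF T, of "Suc i'" j j'] by simp
    qed simp
  qed
qed

lemma drop_add_row:
  assumes "T \<in> staircase_tableaux n"
  shows "drop_row (add_row n T Y s) = T"
proof
  fix x :: "nat \<times> nat"
  obtain i j where x: "x = (i, j)" by (cases x)
  show "drop_row (add_row n T Y s) x = T x"
    using staircase_outside[OF assms, of "(0, j)"]
    by (cases i) (simp_all add: x drop_row_def boxes_def)
qed

text \<open>The first row is determined by its support, which contains the last box, and its leftmost
  symbol: west of a symbol \<open>\<beta>\<close> there is nothing, so all other symbols are \<open>\<alpha>\<close>.\<close>

lemma bij_betw_add_row:
  "bij_betw (\<lambda>(T, Y, s). add_row n T Y s)
     (SIGMA T:staircase_tableaux n. Pow (free_columns n T) \<times> UNIV) (staircase_tableaux (Suc n))"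
proof -
  let ?Y = "\<lambda>S::tableau. {j \<in> {1..n}. S (1, j) \<noteq> None}"
  let ?s = "\<lambda>S::tableau. the (S (1, Min (insert (Suc n) (?Y S))))"
  show ?thesis
  proof (rule bij_betw_byWitness[where f' = "\<lambda>S. (drop_row S, ?Y S, ?s S)"])
    have Y: "?Y (add_row n T Y s) = Y" if "Y \<subseteq> free_columns n T" for T Y s
      using that by (auto simp: free_columns_def)
    have s: "the (add_row n T Y s (1, Min (insert (Suc n) Y))) = s" if "Y \<subseteq> free_columns n T" for T Y s
    proof -
      have "Min (insert (Suc n) Y) \<in> insert (Suc n) Y"
        using finite_subset[OF that] by (intro Min_in) auto
      then show ?thesis by simp
    qed
    show "\<forall>x\<in>SIGMA T:staircase_tableaux n. Pow (free_columns n T) \<times> UNIV.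
        (\<lambda>S. (drop_row S, ?Y S, ?s S)) ((\<lambda>(T, Y, s). add_row n T Y s) x) = x"
    proof
      fix x assume "x \<in> (SIGMA T:staircase_tableaux n. Pow (free_columns n T) \<times> (UNIV :: symbol set))"
      then obtain T Z r where x: "x = (T, Z, r)" and "T \<in> staircase_tableaux n" "Z \<subseteq> free_columns n T"
        by auto
      then show "(\<lambda>S. (drop_row S, ?Y S, ?s S)) ((\<lambda>(T, Y, s). add_row n T Y s) x) = x"
        by (simp only: x prod.case Y s drop_add_row)
    qed
  next
    show "\<forall>S\<in>staircase_tableaux (Suc n). (\<lambda>(T, Y, s). add_row n T Y s) (drop_row S, ?Y S, ?s S) = S"
    proof
      fix S assume S: "S \<in> staircase_tableaux (Suc n)"
      let ?X = "insert (Suc n) (?Y S)"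
      have fin: "finite ?X" by simp
      have mem: "j \<in> ?X \<longleftrightarrow> S (1, j) \<noteq> None" for j
      proof (cases "1 \<le> j \<and> j \<le> n")
        case True
        then show ?thesis by simp
      next
        case False
        then show ?thesis
          using staircase_outside[OF S, of "(1, j)"] staircase_diagonal[OF S, of 1 "Suc n"]
          by (cases "j = Suc n") (auto simp: boxes_def)
      qed
      have row: "S (1, j) = (if j \<in> ?X then Some (if j = Min ?X then ?s S else Alpha) else None)" for j
      proof (cases "j \<in> ?X \<and> j \<noteq> Min ?X")
        case True
        then have "Min ?X \<le> j" "j \<noteq> Min ?X" using Min_le[OF fin, of j] by blast+
        then have less: "Min ?X < j" by linarith
        have "Min ?X \<in> ?X" by (intro Min_in) auto
        then have "S (1, Min ?X) \<noteq> None" using mem by blast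
        then have "S (1, j) \<noteq> Some Beta" using staircase_beta[OF S _ less] by auto
        moreover have "S (1, j) \<noteq> None" using mem True by blast
        ultimately have "S (1, j) = Some Alpha"
          by (metis option.exhaust symbol.exhaust)
        with True show ?thesis by simp
      next
        case False
        show ?thesis
        proof (cases "j \<in> ?X")
          case True
          with False have "j = Min ?X" by blast
          moreover have "S (1, j) \<noteq> None" using mem True by blast
          ultimately show ?thesis using True by auto
        next
          case False
          then have "S (1, j) = None" using mem by blast
          with False show ?thesis by simp
        qed
      qed
      have first: "add_row n (drop_row S) (?Y S) (?s S) (1, j) = S (1, j)" for j
        by (rule trans[OF _ row[of j, symmetric]])
          (simp only: add_row_def prod.case one_neq_zero if_True if_False refl)
      have rest: "add_row n (drop_row S) (?Y S) (?s S) (i, j) = S (i, j)" if "i \<noteq> 1" for i j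
        using that staircase_outside[OF S, of "(0, j)"]
        by (cases "i = 0") (simp_all add: add_row_def drop_row_def boxes_def)
      have "add_row n (drop_row S) (?Y S) (?s S) = S"
      proof
        fix x :: "nat \<times> nat"
        obtain i j where x: "x = (i, j)" by (cases x)
        show "add_row n (drop_row S) (?Y S) (?s S) x = S x"
        proof (cases "i = 1")
          case True
          show ?thesis unfolding x True by (rule first)
        next
          case False
          then show ?thesis unfolding x by (rule rest)
        qed
      qed
      then show "(\<lambda>(T, Y, s). add_row n T Y s) (drop_row S, ?Y S, ?s S) = S"
        by (simp only: prod.case)
    qed
  next
    show "(\<lambda>(T, Y, s). add_row n T Y s) ` (SIGMA T:staircase_tableaux n. Pow (free_columns n T) \<times> UNIV)
        \<subseteq> staircase_tableaux (Suc n)"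
      by (auto intro: add_row_in_staircase)
  next
    have "?Y S \<subseteq> free_columns n (drop_row S)" if S: "S \<in> staircase_tableaux (Suc n)" for S
      using staircase_alpha[OF S, of _ _ 1]
      by (force simp: free_columns_def drop_row_def split: if_splits)
    then show "(\<lambda>S. (drop_row S, ?Y S, ?s S)) ` staircase_tableaux (Suc n)
        \<subseteq> (SIGMA T:staircase_tableaux n. Pow (free_columns n T) \<times> UNIV)"
      by (auto simp: drop_row_in_staircase)
  qed
qed

lemma staircase_Suc_cases:
  assumes "S \<in> staircase_tableaux (Suc n)"
  obtains T Y s where "T \<in> staircase_tableaux n" "Y \<subseteq> free_columns n T" "S = add_row n T Y s"
proof -
  have "S \<in> (\<lambda>(T, Y, s). add_row n T Y s) `
      (SIGMA T:staircase_tableaux n. Pow (free_columns n T) \<times> UNIV)"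
    using assms by (simp only: bij_betw_imp_surj_on[OF bij_betw_add_row[of n]])
  then show thesis
    using that by (elim imageE SigmaE) (simp add: Pow_iff)
qed

text \<open>No column contains two \<open>Alpha\<close>, so the projection of the
  \<open>Alpha\<close> boxes to their columns is injective; its image is the complement of the free
  columns.\<close>

lemma card_free_columns:
  assumes T: "T \<in> staircase_tableaux n"
  shows "card (free_columns n T) + num_symbol Alpha T = n"
proof -
  let ?A = "{x. T x = Some Alpha}"
  have inj: "inj_on snd ?A"
  proof (rule inj_onI)
    fix x y assume "x \<in> ?A" "y \<in> ?A" "snd x = snd y"
    then obtain i i' j where *: "x = (i, j)" "y = (i', j)" "T (i, j) = Some Alpha" "T (i', j) = Some Alpha"
      by (cases x, cases y) auto
    then show "x = y"
      using staircase_alpha[OF T, of i j i'] staircase_alpha[OF T, of i' j i]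
      by (cases i i' rule: linorder_cases) auto
  qed
  have "snd ` ?A = {1..n} - free_columns n T"
    using staircase_in_boxes[OF T] by (force simp: free_columns_def boxes_def)
  then have "num_symbol Alpha T = card ({1..n} - free_columns n T)"
    using card_image[OF inj] by (simp add: num_symbol_def)
  moreover have "free_columns n T \<subseteq> {1..n}" by (auto simp: free_columns_def)
  ultimately show ?thesis
    using card_mono[of "{1..n}" "free_columns n T"] by (simp add: card_Diff_subset)
qed

lemma num_symbol_add_row:
  assumes T: "T \<in> staircase_tableaux n" and Y: "Y \<subseteq> free_columns n T"
  shows "num_symbol Alpha (add_row n T Y s) = num_symbol Alpha T + card Y + (if s = Alpha then 1 else 0)"
    and "num_symbol Beta (add_row n T Y s) = num_symbol Beta T + (if s = Beta then 1 else 0)"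
proof -
  let ?X = "insert (Suc n) Y"
  let ?S = "add_row n T Y s"
  have finY: "finite Y" using finite_subset[OF Y] by simp
  have notin: "Suc n \<notin> Y" using Y by (auto simp: free_columns_def)
  have Min: "Min ?X \<in> ?X" using finY by (intro Min_in) auto
  have split: "num_symbol r ?S = num_symbol r T + card {j \<in> ?X. (if j = Min ?X then s else Alpha) = r}" for r
  proof -
    let ?A = "{x. T x = Some r}"
    let ?B = "{j \<in> ?X. (if j = Min ?X then s else Alpha) = r}"
    have T0: "T (0, j) = None" for j using staircase_outside[OF T] by (simp add: boxes_def)
    have "(i, j) \<in> {x. ?S x = Some r} \<longleftrightarrow>
        (i, j) \<in> (\<lambda>(i, j). (Suc i, j)) ` ?A \<union> (\<lambda>j. (1, j)) ` ?B" for i j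
    proof -
      consider "i = 0" | "i = Suc 0" | i' where "i = Suc (Suc i')" by (metis not0_implies_Suc)
      then show ?thesis
        using T0 by cases (auto simp: image_iff)
    qed
    then have "{x. ?S x = Some r} = (\<lambda>(i, j). (Suc i, j)) ` ?A \<union> (\<lambda>j. (1, j)) ` ?B"
      by (intro set_eqI) (simp only: split_paired_all)
    moreover have "card ((\<lambda>(i, j). (Suc i, j)) ` ?A \<union> (\<lambda>j. (1, j)) ` ?B)
        = card ((\<lambda>(i, j). (Suc i, j)) ` ?A) + card ((\<lambda>j. (1::nat, j)) ` ?B)"
    proof (rule card_Un_disjoint)
      show "finite ((\<lambda>(i, j). (Suc i, j)) ` ?A)" using finite_symbol[OF T] by blast
      show "finite ((\<lambda>j. (1::nat, j)) ` ?B)" using finY by simp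
      show "(\<lambda>(i, j). (Suc i, j)) ` ?A \<inter> (\<lambda>j. (1, j)) ` ?B = {}"
        using T0 by auto
    qed
    moreover have "card ((\<lambda>(i, j). (Suc i, j)) ` ?A) = card ?A"
      by (rule card_image) (auto simp: inj_on_def)
    moreover have "card ((\<lambda>j. (1::nat, j)) ` ?B) = card ?B"
      by (rule card_image) (auto simp: inj_on_def)
    ultimately show ?thesis by (simp add: num_symbol_def)
  qed
  have "{j \<in> ?X. (if j = Min ?X then s else Alpha) = Beta} = (if s = Beta then {Min ?X} else {})"
    using Min by auto
  then show "num_symbol Beta ?S = num_symbol Beta T + (if s = Beta then 1 else 0)"
    using split[of Beta] by (cases "s = Beta") (simp_all only: if_True if_False refl card.empty is_singletonI, simp_all)
  have "{j \<in> ?X. (if j = Min ?X then s else Alpha) = Alpha} = (if s = Alpha then ?X else ?X - {Min ?X})"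
    by auto
  then show "num_symbol Alpha ?S = num_symbol Alpha T + card Y + (if s = Alpha then 1 else 0)"
    using split[of Alpha] Min finY notin
    by (cases "s = Alpha") (simp_all only: if_True if_False refl card_Diff_singleton, simp_all)
qed

text \<open>Each row contains at most one \<open>Beta\<close>. Together with
  \<open>card_free_columns\<close> this makes the truncated subtractions in
  \<open>dual_weight\<close> genuine.\<close>

lemma num_symbol_beta_le:
  "S \<in> staircase_tableaux n \<Longrightarrow> num_symbol Beta S \<le> n"
proof (induction n arbitrary: S)
  case 0
  then have "S x = None" for x using staircase_outside[OF 0, of x] by (cases x) (simp add: boxes_def)
  then show ?case by (simp add: num_symbol_def)
next
  case (Suc n)
  obtain T Y s where T: "T \<in> staircase_tableaux n" and Y: "Y \<subseteq> free_columns n T" and S: "S = add_row n T Y s"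
    using staircase_Suc_cases[OF Suc.prems] .
  then show ?case using Suc.IH[OF T] num_symbol_add_row(2)[OF T Y, of s] by (simp split: if_splits)
qed

text \<open>The weight in terms of \<open>a = 1/\<alpha>\<close> and \<open>b = 1/\<beta>\<close>, divided by \<open>\<alpha>\<^sup>n \<beta>\<^sup>n\<close>: a factor \<open>a\<close> for each column
  without \<open>\<alpha>\<close> and a factor \<open>b\<close> for each row without \<open>\<beta>\<close>. It also makes sense for infinite \<open>\<alpha>\<close> or \<open>\<beta>\<close>.\<close>

definition dual_weight :: "real \<Rightarrow> real \<Rightarrow> nat \<Rightarrow> tableau \<Rightarrow> real" where
  "dual_weight a b n S = a ^ (n - num_symbol Alpha S) * b ^ (n - num_symbol Beta S)"

lemma dual_weight_nonneg: "0 \<le> a \<Longrightarrow> 0 \<le> b \<Longrightarrow> 0 \<le> dual_weight a b n S"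
  by (simp add: dual_weight_def)

lemma dual_weight_eq:
  assumes "T \<in> staircase_tableaux n"
  shows "dual_weight a b n T = a ^ card (free_columns n T) * b ^ (n - num_symbol Beta T)"
proof -
  have "n - num_symbol Alpha T = card (free_columns n T)"
    using card_free_columns[OF assms] by linarith
  then show ?thesis by (simp add: dual_weight_def)
qed

lemma dual_weight_add_row:
  assumes T: "T \<in> staircase_tableaux n" and Y: "Y \<subseteq> free_columns n T"
  shows "dual_weight a b (Suc n) (add_row n T Y s) =
    (if s = Beta then a else b) * (a ^ card (free_columns n T - Y) * b ^ (n - num_symbol Beta T))"
proof -
  have *: "card (free_columns n T - Y) + card Y = card (free_columns n T)"
    using Y by (metis card_Diff_subset card_mono finite_free_columns finite_subset le_add_diff_inverse2)
  have "Suc n - num_symbol Alpha (add_row n T Y s)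
      = card (free_columns n T - Y) + (if s = Beta then 1 else 0)"
    using num_symbol_add_row(1)[OF T Y, of s] card_free_columns[OF T] * by (cases s) auto
  moreover have "Suc n - num_symbol Beta (add_row n T Y s)
      = n - num_symbol Beta T + (if s = Beta then 0 else 1)"
    using num_symbol_add_row(2)[OF T Y, of s] num_symbol_beta_le[OF T] by (cases s) auto
  ultimately show ?thesis by (simp add: dual_weight_def)
qed

text \<open>The leftmost symbol of the first row is either \<open>Alpha\<close> or
  \<open>Beta\<close>, so only one of the two counts can reach \<open>Suc n\<close>. The missing
  symbol supplies the vanishing factor that is cancelled when both weights are infinite.\<close>

lemma num_symbols_le:
  assumes "S \<in> staircase_tableaux (Suc n)"
  shows "num_symbol Alpha S + num_symbol Beta S \<le> 2 * n + 1"
proof -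
  obtain T Y s where T: "T \<in> staircase_tableaux n" and Y: "Y \<subseteq> free_columns n T" and S: "S = add_row n T Y s"
    using staircase_Suc_cases[OF assms] .
  have "card Y \<le> card (free_columns n T)" using Y by (intro card_mono) auto
  then show ?thesis
    using num_symbol_add_row[OF T Y, of s] card_free_columns[OF T] num_symbol_beta_le[OF T]
    by (cases s) (auto simp: S)
qed

section \<open>Weighted sums over tableaux and the contribution of the first row\<close>

definition weighted_sum :: "nat \<Rightarrow> real \<Rightarrow> real \<Rightarrow> (tableau \<Rightarrow> 'c::real_normed_vector) \<Rightarrow> 'c" where
  "weighted_sum n a b f = (\<Sum>S\<in>staircase_tableaux n. dual_weight a b n S *\<^sub>R f S)"

lemma weighted_sum_Suc:
  "weighted_sum (Suc n) a b f =
    (\<Sum>T\<in>staircase_tableaux n. \<Sum>(Y, s)\<in>Pow (free_columns n T) \<times> UNIV.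
      ((if s = Beta then a else b) * (a ^ card (free_columns n T - Y) * b ^ (n - num_symbol Beta T)))
        *\<^sub>R f (add_row n T Y s))"
proof -
  have "weighted_sum (Suc n) a b f = (\<Sum>(T, Y, s)\<in>(SIGMA T:staircase_tableaux n. Pow (free_columns n T) \<times> UNIV).
      dual_weight a b (Suc n) (add_row n T Y s) *\<^sub>R f (add_row n T Y s))"
    unfolding weighted_sum_def
    by (subst sum.reindex_bij_betw[OF bij_betw_add_row[of n], symmetric]) (simp add: split_beta)
  also have "\<dots> = (\<Sum>T\<in>staircase_tableaux n. \<Sum>(Y, s)\<in>Pow (free_columns n T) \<times> UNIV.
      dual_weight a b (Suc n) (add_row n T Y s) *\<^sub>R f (add_row n T Y s))"
    by (subst sum.Sigma[symmetric]) (auto simp: finite_staircase_tableaux UNIV_symbol)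
  also have "\<dots> = (\<Sum>T\<in>staircase_tableaux n. \<Sum>(Y, s)\<in>Pow (free_columns n T) \<times> UNIV.
      ((if s = Beta then a else b) * (a ^ card (free_columns n T - Y) * b ^ (n - num_symbol Beta T)))
        *\<^sub>R f (add_row n T Y s))"
    by (intro sum.cong refl) (auto simp: dual_weight_add_row)
  finally show ?thesis .
qed

lemma sum_Pow_power_card_Diff:
  assumes "finite F"
  shows "(\<Sum>Y\<in>Pow F. a ^ card (F - Y)) = (1 + a :: real) ^ card F"
  using prod_add[OF assms, of "\<lambda>_. 1" "\<lambda>_. a"] by simp

text \<open>Each free column of the remaining tableau either receives a symbol (factor 1) or stays
  unoccupied (factor \<open>a\<close>), which turns \<open>a\<close> into \<open>a + 1\<close>. The
  leftmost symbol contributes \<open>a\<close> if it is \<open>Beta\<close>, as its column stays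
  free, and \<open>b\<close> if it is \<open>Alpha\<close>, as the row then has no
  \<open>Beta\<close>.\<close>

lemma weighted_sum_drop_row:
  "weighted_sum (Suc n) a b (\<lambda>S. g (drop_row S)) = (a + b) *\<^sub>R weighted_sum n (a + 1) b g"
proof -
  have "weighted_sum (Suc n) a b (\<lambda>S. g (drop_row S)) =
      (\<Sum>T\<in>staircase_tableaux n. (a + b) *\<^sub>R dual_weight (a + 1) b n T *\<^sub>R g T)"
    unfolding weighted_sum_Suc
  proof (rule sum.cong[OF refl])
    fix T assume T: "T \<in> staircase_tableaux n"
    let ?F = "free_columns n T" and ?c = "b ^ (n - num_symbol Beta T)"
    have "(\<Sum>(Y, s)\<in>Pow ?F \<times> UNIV. ((if s = Beta then a else b) * (a ^ card (?F - Y) * ?c)) *\<^sub>R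
        g (drop_row (add_row n T Y s))) =
        (\<Sum>(Y, s)\<in>Pow ?F \<times> UNIV. (if s = Beta then a else b) * (a ^ card (?F - Y) * ?c)) *\<^sub>R g T"
      by (simp add: drop_add_row[OF T] scaleR_sum_left split_beta)
    also have "(\<Sum>(Y, s)\<in>Pow ?F \<times> UNIV. (if s = Beta then a else b) * (a ^ card (?F - Y) * ?c))
        = (\<Sum>Y\<in>Pow ?F. (a + b) * ?c * a ^ card (?F - Y))"
      by (simp add: sum.cartesian_product[symmetric] UNIV_symbol algebra_simps)
    also have "\<dots> = (a + b) * dual_weight (a + 1) b n T"
      unfolding sum_distrib_left[symmetric] sum_Pow_power_card_Diff[OF finite_free_columns] dual_weight_eq[OF T]
      by (simp add: ac_simps)
    finally show "(\<Sum>(Y, s)\<in>Pow ?F \<times> UNIV. ((if s = Beta then a else b) * (a ^ card (?F - Y) * ?c)) *\<^sub>R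
        g (drop_row (add_row n T Y s))) = (a + b) *\<^sub>R dual_weight (a + 1) b n T *\<^sub>R g T"
      by simp
  qed
  then show ?thesis by (simp add: weighted_sum_def scaleR_sum_right)
qed

lemma add_row_eq_Beta_iff:
  assumes Y: "Y \<subseteq> free_columns n T"
  shows "add_row n T Y s (1, j) = Some Beta \<longleftrightarrow>
    s = Beta \<and> (j = Suc n \<and> Y = {} \<or> j \<in> Y \<and> Y \<subseteq> {j..})"
proof -
  have fin: "finite Y" using finite_subset[OF Y] by simp
  have le: "l \<le> n" if "l \<in> Y" for l using Y that by (auto simp: free_columns_def)
  have "j \<in> insert (Suc n) Y \<and> j = Min (insert (Suc n) Y) \<longleftrightarrow>
      j = Suc n \<and> Y = {} \<or> j \<in> Y \<and> Y \<subseteq> {j..}"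
    using fin le by (force simp: eq_Min_iff)
  then show ?thesis by (auto simp: One_nat_def)
qed

text \<open>If the first row has its \<open>\<beta>\<close> in column \<open>j\<close>, then it is empty west of it and arbitrary in the free
  columns east of it.\<close>

lemma weighted_sum_first_row_Beta:
  assumes a: "0 < a" and j: "1 \<le> j" "j \<le> n"
  shows "weighted_sum (Suc n) a b (\<lambda>S. of_bool (S (1, j) = Some Beta) *\<^sub>R g (drop_row S)) =
    weighted_sum n a b (\<lambda>T. (of_bool (j \<in> free_columns n T) *
      (1 + 1 / a) ^ card (free_columns n T \<inter> {j<..})) *\<^sub>R g T)"
  unfolding weighted_sum_Suc weighted_sum_def[of n]
proof (rule sum.cong[OF refl])
  fix T assume T: "T \<in> staircase_tableaux n"
  let ?F = "free_columns n T" and ?c = "b ^ (n - num_symbol Beta T)"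
  let ?G = "?F \<inter> {j<..}"
  let ?w = "\<lambda>Y. a * (a ^ card (?F - Y) * ?c)"
  have "(\<Sum>(Y, s)\<in>Pow ?F \<times> UNIV. ((if s = Beta then a else b) * (a ^ card (?F - Y) * ?c)) *\<^sub>R
      (of_bool (add_row n T Y s (1, j) = Some Beta) *\<^sub>R g (drop_row (add_row n T Y s)))) =
      (\<Sum>(Y, s)\<in>Pow ?F \<times> UNIV. (if s = Beta \<and> j \<in> Y \<and> Y \<subseteq> {j..} then ?w Y else 0) *\<^sub>R g T)"
    using j by (intro sum.cong refl) (auto simp: add_row_eq_Beta_iff[unfolded One_nat_def] drop_add_row[OF T] simp del: add_row_simps)
  also have "\<dots> = (\<Sum>Y\<in>Pow ?F. if j \<in> Y \<and> Y \<subseteq> {j..} then ?w Y else 0) *\<^sub>R g T"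
    by (simp add: sum.cartesian_product[symmetric] UNIV_symbol scaleR_sum_left)
  also have "(\<Sum>Y\<in>Pow ?F. if j \<in> Y \<and> Y \<subseteq> {j..} then ?w Y else 0)
      = (\<Sum>Y\<in>{Y \<in> Pow ?F. j \<in> Y \<and> Y \<subseteq> {j..}}. ?w Y)"
    by (rule sum.inter_filter[symmetric]) simp
  also have "\<dots> = dual_weight a b n T * (of_bool (j \<in> ?F) * (1 + 1 / a) ^ card ?G)"
  proof (cases "j \<in> ?F")
    case False
    then have "{Y \<in> Pow ?F. j \<in> Y \<and> Y \<subseteq> {j..}} = {}" by auto
    then show ?thesis using False by (simp only: sum.empty of_bool_def if_False mult_zero_left mult_zero_right)
  next
    case True
    have set: "{Y \<in> Pow ?F. j \<in> Y \<and> Y \<subseteq> {j..}} = insert j ` Pow ?G"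
    proof
      show "{Y \<in> Pow ?F. j \<in> Y \<and> Y \<subseteq> {j..}} \<subseteq> insert j ` Pow ?G"
      proof
        fix Y assume Y: "Y \<in> {Y \<in> Pow ?F. j \<in> Y \<and> Y \<subseteq> {j..}}"
        then have "Y - {j} \<in> Pow ?G" by force
        moreover have "Y = insert j (Y - {j})" using Y by auto
        ultimately show "Y \<in> insert j ` Pow ?G" by (rule rev_image_eqI)
      qed
    qed (use True in auto)
    have inj: "inj_on (insert j) (Pow ?G)"
      by (rule inj_onI) (metis Int_iff PowD greaterThan_iff insert_ident less_irrefl subsetD)
    let ?L = "?F \<inter> {..<j}"
    have "card (?F - insert j Y) = card ?L + card (?G - Y)" if "Y \<subseteq> ?G" for Y
    proof -
      have "?F - insert j Y = ?L \<union> (?G - Y)" using that by force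
      then show ?thesis by (simp add: card_Un_disjoint disjoint_iff)
    qed
    then have "(\<Sum>Y\<in>{Y \<in> Pow ?F. j \<in> Y \<and> Y \<subseteq> {j..}}. ?w Y) = (\<Sum>Y\<in>Pow ?G. a * a ^ card ?L * ?c * a ^ card (?G - Y))"
      unfolding set sum.reindex[OF inj] by (intro sum.cong refl) (simp add: power_add)
    also have "\<dots> = a * a ^ card ?L * ?c * (1 + a) ^ card ?G"
      unfolding sum_distrib_left[symmetric] by (subst sum_Pow_power_card_Diff) simp_all
    \<comment> \<open>Pulling \<open>a ^ card ?G\<close> out of \<open>(1 + a) ^ card ?G\<close>
      completes the dual weight of \<open>T\<close>. The single factor \<open>a\<close> belongs to
      column \<open>j\<close>, which stays free under its new \<open>Beta\<close>.\<close>
    also have "\<dots> = a * a ^ card ?L * a ^ card ?G * ?c * (1 + 1 / a) ^ card ?G"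
      using a by (simp add: field_simps flip: power_mult_distrib)
    also have "a * a ^ card ?L * a ^ card ?G = a ^ card ?F"
    proof -
      have "?F = insert j (?L \<union> ?G)" using True by auto
      then have "card ?F = card (insert j (?L \<union> ?G))" by (rule arg_cong)
      also have "\<dots> = Suc (card ?L + card ?G)" by (subst card_insert_disjoint) (auto simp: card_Un_disjoint disjoint_iff)
      finally show ?thesis by (simp add: power_add)
    qed
    finally show ?thesis using True by (simp add: dual_weight_eq[OF T])
  qed
  finally show "(\<Sum>(Y, s)\<in>Pow ?F \<times> UNIV. ((if s = Beta then a else b) * (a ^ card (?F - Y) * ?c)) *\<^sub>R
      (of_bool (add_row n T Y s (1, j) = Some Beta) *\<^sub>R g (drop_row (add_row n T Y s)))) =
      dual_weight a b n T *\<^sub>R (of_bool (j \<in> ?F) * (1 + 1 / a) ^ card ?G) *\<^sub>R g T"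
    by simp
qed

text \<open>A \<open>Beta\<close> in the last box forces the rest of the row to be empty, so
  \<open>Y = {}\<close> and no free column is used up. Hence the remaining tableau keeps its
  parameter \<open>a\<close>, unlike in \<open>weighted_sum_drop_row\<close>.\<close>

lemma weighted_sum_corner_Beta:
  "weighted_sum (Suc n) a b (\<lambda>S. of_bool (S (1, Suc n) = Some Beta) *\<^sub>R g (drop_row S)) =
    a *\<^sub>R weighted_sum n a b g"
  unfolding weighted_sum_Suc weighted_sum_def[of n] scaleR_sum_right
proof (rule sum.cong[OF refl])
  fix T assume T: "T \<in> staircase_tableaux n"
  let ?F = "free_columns n T" and ?c = "b ^ (n - num_symbol Beta T)"
  have notin: "Suc n \<notin> Y" if "Y \<subseteq> ?F" for Y using that by (auto simp: free_columns_def)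
  have "(\<Sum>(Y, s)\<in>Pow ?F \<times> UNIV. ((if s = Beta then a else b) * (a ^ card (?F - Y) * ?c)) *\<^sub>R
      (of_bool (add_row n T Y s (1, Suc n) = Some Beta) *\<^sub>R g (drop_row (add_row n T Y s)))) =
      (\<Sum>(Y, s)\<in>Pow ?F \<times> UNIV. (if Y = {} \<and> s = Beta then a * (a ^ card ?F * ?c) else 0) *\<^sub>R g T)"
    using notin by (intro sum.cong refl) (auto simp: add_row_eq_Beta_iff[unfolded One_nat_def] drop_add_row[OF T] simp del: add_row_simps)
  also have "\<dots> = (\<Sum>Y\<in>Pow ?F. if Y = {} then a * (a ^ card ?F * ?c) else 0) *\<^sub>R g T"
    by (simp add: sum.cartesian_product[symmetric] UNIV_symbol scaleR_sum_left del: sum.delta)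
  also have "(\<Sum>Y\<in>Pow ?F. if Y = {} then a * (a ^ card ?F * ?c) else 0) = a * (a ^ card ?F * ?c)"
    by (subst sum.delta) simp_all
  also have "\<dots> *\<^sub>R g T = a *\<^sub>R dual_weight a b n T *\<^sub>R g T"
    by (simp add: dual_weight_eq[OF T])
  finally show "(\<Sum>(Y, s)\<in>Pow ?F \<times> UNIV. ((if s = Beta then a else b) * (a ^ card (?F - Y) * ?c)) *\<^sub>R
      (of_bool (add_row n T Y s (1, Suc n) = Some Beta) *\<^sub>R g (drop_row (add_row n T Y s)))) =
      a *\<^sub>R dual_weight a b n T *\<^sub>R g T" .
qed

lemma staircase_tableaux_0: "staircase_tableaux 0 = {\<lambda>_. None}"
proof
  have boxes: "boxes 0 = {}" by (auto simp: boxes_def)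
  show "staircase_tableaux 0 \<subseteq> {\<lambda>_. None}"
    using staircase_outside[of _ 0] by (auto simp: boxes)
  show "{\<lambda>_. None} \<subseteq> staircase_tableaux 0"
    unfolding staircase_tableaux_def boxes by simp
qed

text \<open>Peeling off the rows gives the factors a + b, a + b + 1, and so on. For positive finite
  weights this is the partition function divided by its factor
  \<open>\<alpha>^n * \<beta>^n\<close>.\<close>

lemma weighted_sum_1: "weighted_sum n a b (\<lambda>_. 1 :: real) = pochhammer (a + b) n"
proof (induction n arbitrary: a)
  case 0
  show ?case by (simp add: weighted_sum_def staircase_tableaux_0 dual_weight_def)
next
  case (Suc n)
  show ?case
    using weighted_sum_drop_row[of n a b "\<lambda>_. 1 :: real"] Suc[of "a + 1"]
    by (simp add: pochhammer_rec add_ac)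
qed

text \<open>For \<open>a = b = 0\<close> and \<open>n > 0\<close> the normaliser is 0, so later
  lemmas assume \<open>a + b > 0\<close>. Values in a normed space cover both probabilities and
  complex generating functions.\<close>

definition expect :: "nat \<Rightarrow> real \<Rightarrow> real \<Rightarrow> (tableau \<Rightarrow> 'c::real_normed_vector) \<Rightarrow> 'c" where
  "expect n a b f = weighted_sum n a b f /\<^sub>R pochhammer (a + b) n"

lemma expect_cong:
  "(\<And>S. S \<in> staircase_tableaux n \<Longrightarrow> f S = g S) \<Longrightarrow> expect n a b f = expect n a b g"
  by (simp add: expect_def weighted_sum_def)

lemma expect_add: "expect n a b (\<lambda>S. f S + g S) = expect n a b f + expect n a b g"
  by (simp add: expect_def weighted_sum_def sum.distrib algebra_simps)

lemma expect_diff: "expect n a b (\<lambda>S. f S - g S) = expect n a b f - expect n a b g"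
  by (simp add: expect_def weighted_sum_def sum_subtractf algebra_simps)

lemma expect_cmult:
  fixes c :: "'c::real_normed_algebra"
  shows "expect n a b (\<lambda>S. c * f S) = c * expect n a b f"
  by (simp add: expect_def weighted_sum_def sum_distrib_left)

lemma expect_sum: "expect n a b (\<lambda>S. \<Sum>i\<in>I. f i S) = (\<Sum>i\<in>I. expect n a b (f i))"
  unfolding expect_def weighted_sum_def scaleR_sum_right by (rule sum.swap)

context
  fixes a b :: real
  assumes nonneg: "0 \<le> a" "0 \<le> b" and pos: "0 < a + b"
begin

lemma pochhammer_dual_pos: "0 < pochhammer (a + b) n"
  using pos by (simp add: pochhammer_pos)

lemma expect_const: "expect n a b (\<lambda>_. c) = c"
proof -
  have "(\<Sum>S\<in>staircase_tableaux n. dual_weight a b n S) = pochhammer (a + b) n"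
    using weighted_sum_1[of n a b] by (simp add: weighted_sum_def)
  then show ?thesis
    using pochhammer_dual_pos[of n] by (simp add: expect_def weighted_sum_def flip: scaleR_sum_left)
qed

lemma expect_mono:
  fixes f g :: "tableau \<Rightarrow> real"
  assumes "\<And>S. S \<in> staircase_tableaux n \<Longrightarrow> f S \<le> g S"
  shows "expect n a b f \<le> expect n a b g"
  unfolding expect_def weighted_sum_def
  using pochhammer_dual_pos[of n] assms dual_weight_nonneg[OF nonneg]
  by (intro scaleR_left_mono sum_mono) (auto intro: mult_left_mono)

lemma norm_expect_le:
  assumes "\<And>S. S \<in> staircase_tableaux n \<Longrightarrow> norm (f S) \<le> g S"
  shows "norm (expect n a b f) \<le> expect n a b g"
proof -
  have "norm (weighted_sum n a b f) \<le> weighted_sum n a b g"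
    unfolding weighted_sum_def
    using assms dual_weight_nonneg[OF nonneg]
    by (intro order_trans[OF norm_sum] sum_mono) (auto intro: mult_left_mono)
  then show ?thesis
    using pochhammer_dual_pos[of n] by (simp add: expect_def divide_right_mono divide_inverse)
qed

lemma expect_drop_row: "expect (Suc n) a b (\<lambda>S. g (drop_row S)) = expect n (a + 1) b g"
  using pos by (simp add: expect_def weighted_sum_drop_row pochhammer_rec add_ac)

text \<open>The parameters on both sides agree, so the quotient of the normalisers is the last
  factor of \<open>pochhammer\<close>; in \<open>expect_drop_row\<close> it is the first factor that
  cancels.\<close>

lemma expect_corner_Beta:
  "expect (Suc n) a b (\<lambda>S. of_bool (S (1, Suc n) = Some Beta) *\<^sub>R g (drop_row S)) =
    (a / (a + b + n)) *\<^sub>R expect n a b g"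
  unfolding expect_def weighted_sum_corner_Beta by (simp add: pochhammer_Suc divide_inverse)

lemma expect_first_row_Beta:
  assumes "0 < a" "1 \<le> j" "j \<le> n"
  shows "expect (Suc n) a b (\<lambda>S. of_bool (S (1, j) = Some Beta) *\<^sub>R g (drop_row S)) =
    expect n a b (\<lambda>T. (of_bool (j \<in> free_columns n T) *
      (1 + 1 / a) ^ card (free_columns n T \<inter> {j<..})) *\<^sub>R g T) /\<^sub>R (a + b + n)"
  unfolding expect_def weighted_sum_first_row_Beta[OF assms] by (simp add: pochhammer_Suc)

end

lemma expect_funpow_drop_row:
  assumes "0 \<le> a" "0 \<le> b" "0 < a + b"
  shows "expect (n + i) a b (\<lambda>S. g ((drop_row ^^ i) S)) = expect n (a + i) b g"
  using assms
proof (induction i arbitrary: a)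
  case (Suc i)
  have "expect (n + Suc i) a b (\<lambda>S. g ((drop_row ^^ Suc i) S)) =
      expect (Suc (n + i)) a b (\<lambda>S. g ((drop_row ^^ i) (drop_row S)))"
    by (simp add: funpow_swap1)
  also have "\<dots> = expect (n + i) (a + 1) b (\<lambda>S. g ((drop_row ^^ i) S))"
    using Suc.prems by (rule expect_drop_row)
  also have "\<dots> = expect n (a + Suc i) b g"
    using Suc.prems by (subst Suc.IH) (auto simp: add_ac)
  finally show ?case .
qed simp

section \<open>The recursion for the generating function\<close>

text \<open>Diagonals are numbered from the outermost one, so removing the first row keeps the
  number \<open>k\<close>. The only box lost is the one in row 1, where 1 + j + k = (n + 1) +
  2.\<close>

lemma beta_count_drop_row:
  assumes S: "S \<in> staircase_tableaux (Suc n)" and k: "1 \<le> k" "k \<le> Suc n"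
  shows "beta_count (Suc n) k S = beta_count n k (drop_row S) + of_bool (S (1, n + 2 - k) = Some Beta)"
proof -
  let ?A = "{x \<in> diagonal n k. drop_row S x = Some Beta}"
  let ?B = "{x. x = (1, n + 2 - k) \<and> S x = Some Beta}"
  have mem: "(i, j) \<in> diagonal (Suc n) k \<longleftrightarrow> 1 \<le> i \<and> 1 \<le> j \<and> i + j + k = n + 3"
    and mem': "(i, j) \<in> diagonal n k \<longleftrightarrow> 1 \<le> i \<and> 1 \<le> j \<and> i + j + k = n + 2" for i j
    using k by (auto simp: diagonal_def boxes_def)
  have "{x \<in> diagonal (Suc n) k. S x = Some Beta} = (\<lambda>(i, j). (Suc i, j)) ` ?A \<union> ?B"
  proof (rule set_eqI)
    fix x :: "nat \<times> nat"
    obtain i j where x: "x = (i, j)" by (cases x)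
    consider "i = 0" | "i = 1" | l where "i = Suc (Suc l)" by (metis One_nat_def not0_implies_Suc)
    then show "x \<in> {x \<in> diagonal (Suc n) k. S x = Some Beta} \<longleftrightarrow>
        x \<in> (\<lambda>(i, j). (Suc i, j)) ` ?A \<union> ?B"
    proof cases
      case 2
      have "x \<notin> (\<lambda>(i, j). (Suc i, j)) ` ?A" using 2 x mem' by auto
      moreover have "1 \<le> j \<and> 1 + j + k = n + 3 \<longleftrightarrow> j = n + 2 - k" using k by linarith
      ultimately show ?thesis using 2 x mem[of i j] by auto
    next
      case (3 l)
      have "x \<in> (\<lambda>(i, j). (Suc i, j)) ` ?A \<longleftrightarrow> (Suc l, j) \<in> ?A" using 3 x by force
      then show ?thesis using 3 x mem[of i j] mem'[of "Suc l" j] by (auto simp: drop_row_def)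
    qed (use x mem in auto)
  qed
  moreover have "finite ?A" by (rule finite_subset[OF _ finite_boxes[of n]]) (auto simp: diagonal_def)
  moreover have "finite ?B" by (rule finite_subset[of _ "{(1, n + 2 - k)}"]) auto
  moreover have "(\<lambda>(i, j). (Suc i, j)) ` ?A \<inter> ?B = {}" using mem' by auto
  moreover have "card ((\<lambda>(i, j). (Suc i, j)) ` ?A) = card ?A"
    by (rule card_image) (auto simp: inj_on_def)
  moreover have "card ?B = of_bool (S (1, n + 2 - k) = Some Beta)"
  proof (cases "S (1, n + 2 - k) = Some Beta")
    case True
    then have "?B = {(1, n + 2 - k)}" by auto
    then have "card ?B = card {(1::nat, n + 2 - k)}" by (rule arg_cong)
    then show ?thesis using True by simp
  next
    case False
    then have "?B = {}" by auto
    then have "card ?B = card ({} :: (nat \<times> nat) set)" by (rule arg_cong)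
    then show ?thesis using False by simp
  qed
  ultimately show ?thesis unfolding beta_count_def by (simp add: card_Un_disjoint)
qed

lemma beta_count_eq_0: "n < k \<Longrightarrow> beta_count n k S = 0"
proof -
  assume "n < k"
  then have "{x \<in> diagonal n k. S x = Some Beta} = {}" by (auto simp: diagonal_def boxes_def)
  then show ?thesis unfolding beta_count_def by (simp only: card.empty)
qed

lemma card_free_columns_greaterThan_le: "card (free_columns n T \<inter> {j<..}) \<le> n - j"
proof -
  have "free_columns n T \<inter> {j<..} \<subseteq> {j<..n}" by (auto simp: free_columns_def)
  then have "card (free_columns n T \<inter> {j<..}) \<le> card {j<..n}" by (intro card_mono) auto
  then show ?thesis by simp
qed

text \<open>As a convex function of \<open>y\<close>, the power lies below its chord on [0, 1],
  whose slope is \<open>2 ^ m - 1\<close>; the weaker slope \<open>2 ^ q\<close> no longer depends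
  on \<open>m\<close>.\<close>

lemma power_one_plus_le:
  fixes y :: real
  assumes "0 \<le> y" "y \<le> 1" "m \<le> q"
  shows "(1 + y) ^ m \<le> 1 + y * 2 ^ q"
proof -
  have "(1 + y) ^ m \<le> 1 + y * (2 ^ m - 1)"
  proof (induction m)
    case (Suc m)
    have "y * (y * (2 ^ m - 1)) \<le> 1 * (y * (2 ^ m - 1))"
      using assms by (intro mult_right_mono mult_nonneg_nonneg) auto
    then show ?case
      using mult_left_mono[OF Suc, of "1 + y"] assms by (simp add: algebra_simps)
  qed simp
  also have "\<dots> \<le> 1 + y * 2 ^ q"
  proof -
    have "(2 :: real) ^ m \<le> 2 ^ q" using assms by (intro power_increasing) auto
    then have "(2 :: real) ^ m - 1 \<le> 2 ^ q" by linarith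
    then show ?thesis using assms by (intro add_left_mono mult_left_mono) auto
  qed
  finally show ?thesis .
qed

lemma funpow_drop_row: "(drop_row ^^ i) S (Suc r, j) = S (Suc r + i, j)"
  by (induction i arbitrary: S) (simp_all add: funpow_swap1 drop_row_def)

context
  fixes a b :: real
  assumes a: "1 \<le> a" and b: "0 \<le> b"
begin

text \<open>The count changes only through a \<open>Beta\<close> in column \<open>n + 2 - k\<close>
  of the removed row. At most k - 2 columns of the remaining tableau lie east of it, and each
  contributes a factor 1 + 1/a <= 2.\<close>

lemma expect_beta_count_drop_row:
  assumes k: "2 \<le> k"
  shows "expect (Suc n) a b (\<lambda>S. of_bool (beta_count (Suc n) k S \<noteq> beta_count n k (drop_row S)) :: real)
    \<le> 2 ^ k / (a + b + n)"
proof (cases "k \<le> Suc n")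
  case False
  then have "expect (Suc n) a b (\<lambda>S. of_bool (beta_count (Suc n) k S \<noteq> beta_count n k (drop_row S)) :: real)
      = expect (Suc n) a b (\<lambda>_. 0)"
    by (intro expect_cong) (simp add: beta_count_eq_0)
  then show ?thesis using a b by (simp add: expect_const)
next
  case True
  let ?j = "n + 2 - k"
  have "expect (Suc n) a b (\<lambda>S. of_bool (beta_count (Suc n) k S \<noteq> beta_count n k (drop_row S)) :: real)
      = expect (Suc n) a b (\<lambda>S. of_bool (S (1, ?j) = Some Beta) *\<^sub>R 1)"
    using k True by (intro expect_cong) (simp add: beta_count_drop_row)
  also have "\<dots> = expect n a b (\<lambda>T. (of_bool (?j \<in> free_columns n T) *
      (1 + 1 / a) ^ card (free_columns n T \<inter> {?j<..})) *\<^sub>R 1) /\<^sub>R (a + b + n)"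
    using a b k True by (intro expect_first_row_Beta) auto
  also have "\<dots> \<le> expect n a b (\<lambda>_. 2 ^ k) /\<^sub>R (a + b + n)"
  proof (intro scaleR_left_mono expect_mono)
    fix T
    have "(1 + 1 / a) ^ card (free_columns n T \<inter> {?j<..}) \<le> 2 ^ card (free_columns n T \<inter> {?j<..})"
      using a by (intro power_mono) auto
    also have "\<dots> \<le> 2 ^ k"
      using card_free_columns_greaterThan_le[of n T ?j] k by (intro power_increasing) auto
    finally show "(of_bool (?j \<in> free_columns n T) *
        (1 + 1 / a) ^ card (free_columns n T \<inter> {?j<..})) *\<^sub>R 1 \<le> (2 ^ k :: real)"
      by auto
  qed (use a b in auto)
  finally show ?thesis using a b by (simp add: expect_const divide_inverse mult.commute)
qed

end

text \<open>Union bound over the removed rows. Each removal raises \<open>a\<close> and lowers the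
  size by one, so all \<open>r\<close> summands have the same denominator.\<close>

lemma expect_beta_count_funpow_drop_row:
  assumes "1 \<le> a" "0 \<le> b" "2 \<le> k"
  shows "expect (n + r) a b (\<lambda>S. of_bool (beta_count (n + r) k S \<noteq> beta_count n k ((drop_row ^^ r) S)) :: real)
    \<le> r * 2 ^ k / (a + b + n + r - 1)"
  using assms(1)
proof (induction r arbitrary: a)
  case 0
  then show ?case using assms by (simp add: expect_const)
next
  case (Suc r)
  have pos: "0 \<le> a" "0 \<le> b" "0 < a + b" using Suc.prems assms by auto
  have "expect (n + Suc r) a b
      (\<lambda>S. of_bool (beta_count (n + Suc r) k S \<noteq> beta_count n k ((drop_row ^^ Suc r) S)) :: real)
    \<le> expect (n + Suc r) a b
      (\<lambda>S. of_bool (beta_count (Suc (n + r)) k S \<noteq> beta_count (n + r) k (drop_row S)) +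
        of_bool (beta_count (n + r) k (drop_row S) \<noteq> beta_count n k ((drop_row ^^ r) (drop_row S))))"
    by (intro expect_mono pos) (auto simp: funpow_swap1)
  also have "\<dots> = expect (Suc (n + r)) a b
        (\<lambda>S. of_bool (beta_count (Suc (n + r)) k S \<noteq> beta_count (n + r) k (drop_row S))) +
      expect (n + r) (a + 1) b
        (\<lambda>S. of_bool (beta_count (n + r) k S \<noteq> beta_count n k ((drop_row ^^ r) S)))"
    unfolding expect_add using expect_drop_row[OF pos, of "n + r"] by simp
  also have "\<dots> \<le> 2 ^ k / (a + b + real (n + r)) + r * 2 ^ k / (a + 1 + b + n + r - 1)"
    using Suc.prems Suc.IH[of "a + 1"] by (intro add_mono expect_beta_count_drop_row assms) simp_all
  also have "\<dots> = real (Suc r) * 2 ^ k / (a + b + n + Suc r - 1)"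
  proof -
    have "a + 1 + b + n + r - 1 = a + b + real (n + r)" "a + b + n + Suc r - 1 = a + b + real (n + r)"
      by simp_all
    then show ?thesis by (simp only: add_divide_distrib[symmetric]) (simp add: algebra_simps)
  qed
  finally show ?case .
qed

text \<open>Erasing a symbol \<open>\<alpha>\<close> off the first diagonal frees its column.\<close>

lemma expect_erase_Alpha:
  assumes a: "0 < a" and b: "0 \<le> b" and off: "i + j \<noteq> n + 1"
  shows "a * expect n a b (\<lambda>S. of_bool (S (i, j) = Some Alpha \<and> S x = Some Beta))
    \<le> expect n a b (\<lambda>S. of_bool (S x = Some Beta))"
proof -
  let ?A = "{S \<in> staircase_tableaux n. S (i, j) = Some Alpha \<and> S x = Some Beta}"
  let ?B = "{S \<in> staircase_tableaux n. S x = Some Beta}"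
  let ?e = "\<lambda>S :: tableau. S((i, j) := None)"
  have fin: "finite ?A" "finite ?B" using finite_staircase_tableaux by auto
  \<comment> \<open>The erased symbol is known to be \<open>Alpha\<close>, so it can be restored.
    The map multiplies the dual weight by \<open>a\<close> and lands in \<open>?B\<close>, which
    gives the inequality.\<close>
  have inj: "inj_on ?e ?A"
  proof (rule inj_onI)
    fix S T assume "S \<in> ?A" "T \<in> ?A" and eq: "?e S = ?e T"
    then have "S (i, j) = T (i, j)" by simp
    moreover have "S y = T y" if "y \<noteq> (i, j)" for y using fun_cong[OF eq, of y] that by simp
    ultimately show "S = T" by (metis ext)
  qed
  have sub: "?e ` ?A \<subseteq> ?B"
  proof (rule image_subsetI)
    fix S assume S: "S \<in> ?A"
    then have S': "S \<in> staircase_tableaux n" and x: "x \<noteq> (i, j)" "S x = Some Beta" by auto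
    have "?e S \<in> staircase_tableaux n"
      unfolding staircase_tableaux_def mem_Collect_eq
    proof (intro conjI allI impI)
      fix y assume "y \<notin> boxes n" then show "?e S y = None" using staircase_outside[OF S'] by simp
    next
      fix r l assume "(r, l) \<in> boxes n" "r + l = n + 1"
      then show "?e S (r, l) \<noteq> None" using off staircase_diagonal[OF S', of r l] by (auto simp: boxes_def)
    next
      fix r l r' assume "?e S (r, l) = Some Alpha" "r' < r"
      then show "?e S (r', l) = None" using staircase_alpha[OF S', of r l r'] by (auto split: if_splits)
    next
      fix r l l' assume "?e S (r, l) = Some Beta" "l' < l"
      then show "?e S (r, l') = None" using staircase_beta[OF S', of r l l'] by (auto split: if_splits)
    qed
    then show "?e S \<in> ?B" using x by simp
  qed
  have weight: "dual_weight a b n (?e S) = a * dual_weight a b n S" if "S \<in> ?A" for S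
  proof -
    have S: "S \<in> staircase_tableaux n" and ij: "S (i, j) = Some Alpha" using that by auto
    have "{y. S y = Some Alpha} = insert (i, j) {y. ?e S y = Some Alpha}" using ij by auto
    moreover have "finite {y. ?e S y = Some Alpha}"
      by (rule finite_subset[OF _ finite_symbol[OF S, of Alpha]]) auto
    ultimately have "num_symbol Alpha S = Suc (num_symbol Alpha (?e S))"
      unfolding num_symbol_def by (simp only: card_insert_disjoint) simp
    moreover have "{y. ?e S y = Some Beta} = {y. S y = Some Beta}" using ij by auto
    then have "num_symbol Beta (?e S) = num_symbol Beta S" unfolding num_symbol_def by simp
    moreover have "num_symbol Alpha S \<le> n" using card_free_columns[OF S] by simp
    ultimately have "n - num_symbol Alpha (?e S) = Suc (n - num_symbol Alpha S)"
      and "num_symbol Beta (?e S) = num_symbol Beta S" by linarith+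
    then show ?thesis by (simp add: dual_weight_def)
  qed
  have "a * (\<Sum>S\<in>?A. dual_weight a b n S) = (\<Sum>S\<in>?e ` ?A. dual_weight a b n S)"
    unfolding sum.reindex[OF inj] sum_distrib_left by (intro sum.cong refl) (simp add: weight)
  also have "\<dots> \<le> (\<Sum>S\<in>?B. dual_weight a b n S)"
    using fin sub a b by (intro sum_mono2) (auto intro: dual_weight_nonneg)
  finally have *: "a * (\<Sum>S\<in>?A. dual_weight a b n S) \<le> (\<Sum>S\<in>?B. dual_weight a b n S)" .
  have sum: "(\<Sum>S\<in>staircase_tableaux n. dual_weight a b n S *\<^sub>R of_bool (P S))
      = (\<Sum>S\<in>{S \<in> staircase_tableaux n. P S}. dual_weight a b n S)" for P
    using finite_staircase_tableaux by (simp add: sum.inter_filter of_bool_def if_distrib cong: if_cong)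
  have "0 < pochhammer (a + b) n" using a b by (intro pochhammer_pos) simp
  then show ?thesis
    using * unfolding expect_def weighted_sum_def sum by (simp add: field_simps)
qed

lemma norm_power_diff_le:
  fixes x :: complex
  assumes "norm x \<le> 1"
  shows "norm (x ^ m - x ^ l) \<le> 2 * of_bool (m \<noteq> l)"
proof -
  have "norm (x ^ m) \<le> 1" "norm (x ^ l) \<le> 1"
    using assms by (simp_all add: norm_power power_le_one)
  then show ?thesis using norm_triangle_ineq4[of "x ^ m" "x ^ l"] by auto
qed

text \<open>Removing the \<open>q\<close> rows above turns \<open>a\<close> into
  \<open>a + q\<close> and makes the box the last one of the first row. Its \<open>Beta\<close>
  empties the rest of that row, so removing this row as well leaves \<open>a + q\<close>
  unchanged.\<close>

lemma expect_beta_box: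
  fixes g :: "tableau \<Rightarrow> 'c::real_normed_vector"
  assumes "0 \<le> a" "0 \<le> b" "0 < a + b"
  shows "expect (m + q + 1) a b (\<lambda>T. of_bool (T (q + 1, m + 1) = Some Beta) *\<^sub>R g ((drop_row ^^ (q + 1)) T))
    = ((a + q) / (a + b + m + q)) *\<^sub>R expect m (a + q) b g"
proof -
  have "expect (m + q + 1) a b (\<lambda>T. of_bool (T (q + 1, m + 1) = Some Beta) *\<^sub>R g ((drop_row ^^ (q + 1)) T))
    = expect (Suc m + q) a b (\<lambda>T. (\<lambda>S. of_bool (S (1, Suc m) = Some Beta) *\<^sub>R g (drop_row S)) ((drop_row ^^ q) T))"
    by (simp add: funpow_drop_row)
  also have "\<dots> = expect (Suc m) (a + q) b (\<lambda>S. of_bool (S (1, Suc m) = Some Beta) *\<^sub>R g (drop_row S))"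
    using assms by (rule expect_funpow_drop_row)
  also have "\<dots> = ((a + q) / (a + q + b + m)) *\<^sub>R expect m (a + q) b g"
    using assms by (intro expect_corner_Beta) auto
  finally show ?thesis by (simp add: add_ac)
qed

text \<open>The arguments \<open>n\<close> and \<open>a\<close> come last because the recursion
  varies exactly these two.\<close>

definition beta_pgf :: "nat \<Rightarrow> complex \<Rightarrow> real \<Rightarrow> nat \<Rightarrow> real \<Rightarrow> complex" where
  "beta_pgf k x b n a = expect n a b (\<lambda>S. x ^ beta_count n k S)"

lemma norm_beta_pgf_le:
  assumes "norm x \<le> 1" "1 \<le> a" "0 \<le> b"
  shows "norm (beta_pgf k x b n a) \<le> 1"
proof -
  have "norm (beta_pgf k x b n a) \<le> expect n a b (\<lambda>_. 1)"
    unfolding beta_pgf_def using assms by (intro norm_expect_le) (auto simp: norm_power power_le_one)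
  then show ?thesis using assms by (simp add: expect_const)
qed

lemma beta_pgf_less: "n < k \<Longrightarrow> 1 \<le> a \<Longrightarrow> 0 \<le> b \<Longrightarrow> beta_pgf k x b n a = 1"
  by (simp add: beta_pgf_def beta_count_eq_0 expect_const)

text \<open>A \<open>\<beta>\<close> in the box \<open>(1, m + 1)\<close> of the \<open>k\<close>-th diagonal, \<open>k = q + 2\<close>, requires column \<open>m + 1\<close> of the remaining
  tableau to be free, hence its box on the first diagonal, in row \<open>q + 1\<close>, to be \<open>\<beta>\<close>. Up to errors of
  relevant order this is the only condition, and the first \<open>q + 1\<close> remaining rows do not contribute to
  the count; a row with \<open>\<beta>\<close> on the first diagonal is otherwise empty, so the tableau below it keeps its
  parameters.\<close>

lemma beta_pgf_step:
  assumes x: "norm x \<le> 1" and a: "1 \<le> a" and b: "0 \<le> b"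
  shows "norm (beta_pgf (q + 2) x b (m + q + 2) a - beta_pgf (q + 2) x b (m + q + 1) (a + 1)
      - (x - 1) * of_real ((a + q) / ((a + b + m + q + 1) * (a + b + m + q))) * beta_pgf (q + 2) x b m (a + q))
    \<le> real (2 * ((2 ^ q + q) * (q + 1) + 2 * (q + 1) * 2 ^ (q + 2))) / ((a + b + m + q + 1) * (a + b + m + q))"
proof -
  let ?k = "q + 2" and ?N = "m + q + 1"
  let ?s = "a + b + m + q"
  let ?F = "\<lambda>T. m + 1 \<in> free_columns ?N T"
  let ?D = "\<lambda>T :: tableau. T (q + 1, m + 1) = Some Beta"
  let ?f = "\<lambda>T. (1 + 1 / a) ^ card (free_columns ?N T \<inter> {m + 1<..})"
  let ?B = "beta_count ?N ?k" and ?B' = "\<lambda>T. beta_count m ?k ((drop_row ^^ (q + 1)) T)"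
  have pos: "0 \<le> a" "0 \<le> b" "0 < a + b" "0 < a" and s: "1 \<le> ?s" using a b by auto
  \<comment> \<open>The removed row adds 0 or 1 to the exponent, and x^(c+1) = x^c + (x - 1)
    x^c.\<close>
  have "beta_pgf ?k x b (m + q + 2) a = expect (Suc ?N) a b
      (\<lambda>S. x ^ ?B (drop_row S) + (x - 1) * (of_bool (S (1, m + 1) = Some Beta) *\<^sub>R x ^ ?B (drop_row S)))"
    unfolding beta_pgf_def
    by (simp, intro expect_cong) (auto simp: beta_count_drop_row algebra_simps)
  also have "\<dots> = beta_pgf ?k x b ?N (a + 1) + (x - 1) *
      (expect ?N a b (\<lambda>T. (of_bool (?F T) * ?f T) *\<^sub>R x ^ ?B T) /\<^sub>R (a + b + ?N))"
    unfolding expect_add expect_cmult beta_pgf_def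
    using expect_first_row_Beta[OF pos(1-4), of "m + 1" ?N "\<lambda>S. x ^ ?B S"]
      expect_drop_row[OF pos(1-3), of ?N "\<lambda>S. x ^ ?B S"] by simp
  finally have rec: "beta_pgf ?k x b (m + q + 2) a - beta_pgf ?k x b ?N (a + 1) =
      (x - 1) * (expect ?N a b (\<lambda>T. (of_bool (?F T) * ?f T) *\<^sub>R x ^ ?B T) /\<^sub>R (?s + 1))"
    by (simp add: add_ac)
  \<comment> \<open>\<open>?\<psi>\<close> is the exact contribution of the first row.
    \<open>?\<chi>\<close> replaces freeness of the column by its consequence \<open>?D\<close>,
    drops the power of 1 + 1/a, and counts only below row \<open>q + 1\<close>; it can be evaluated
    exactly.\<close>
  let ?\<psi> = "expect ?N a b (\<lambda>T. (of_bool (?F T) * ?f T) *\<^sub>R x ^ ?B T)"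
  let ?\<chi> = "expect ?N a b (\<lambda>T. of_bool (?D T) *\<^sub>R x ^ ?B' T)"
  let ?p = "expect ?N a b (\<lambda>T. of_bool (?D T) :: real)"
  have \<chi>: "?\<chi> = ((a + q) / ?s) *\<^sub>R beta_pgf ?k x b m (a + q)"
    unfolding beta_pgf_def using expect_beta_box[OF pos(1-3), of m q "\<lambda>T. x ^ beta_count m ?k T"] by simp
  have p: "?p = (a + q) / ?s"
    using expect_beta_box[OF pos(1-3), of m q "\<lambda>T. 1 :: real"] pos by (simp add: expect_const)
  \<comment> \<open>The three summands bound the deviation of the power from 1, the case that
    \<open>?D\<close> holds but an \<open>Alpha\<close> higher up blocks the column, and a
    contribution of the first q + 1 rows to the count.\<close>
  have diff: "norm (?\<psi> - ?\<chi>) \<le> expect ?N a b (\<lambda>T. 2 ^ q / a * of_bool (?D T) +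
      (\<Sum>i\<in>{1..q}. of_bool (T (i, m + 1) = Some Alpha \<and> ?D T)) + 2 * of_bool (?B T \<noteq> ?B' T))"
    unfolding expect_diff[symmetric]
  proof (intro norm_expect_le pos)
    fix T assume T: "T \<in> staircase_tableaux ?N"
    have diag: "?F T \<Longrightarrow> ?D T"
      using staircase_diagonal[OF T, of "q + 1" "m + 1"]
      by (cases "T (q + 1, m + 1)") (auto simp: free_columns_def, metis symbol.exhaust)
    have xB: "norm (x ^ ?B T) \<le> 1" using x by (simp add: norm_power power_le_one)
    have nonneg: "0 \<le> (\<Sum>i\<in>{1..q}. of_bool (T (i, m + 1) = Some Alpha \<and> ?D T) :: real)"
      by (intro sum_nonneg) simp
    consider "\<not> ?D T" | "?D T" "?F T" | "?D T" "\<not> ?F T" by blast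
    then show "norm ((of_bool (?F T) * ?f T) *\<^sub>R x ^ ?B T - of_bool (?D T) *\<^sub>R x ^ ?B' T) \<le>
        2 ^ q / a * of_bool (?D T) + (\<Sum>i\<in>{1..q}. of_bool (T (i, m + 1) = Some Alpha \<and> ?D T))
        + 2 * of_bool (?B T \<noteq> ?B' T)"
    proof cases
      case 1
      then have "\<not> ?F T" using diag by blast
      with 1 show ?thesis by simp
    next
      case 2
      have f: "1 \<le> ?f T" "?f T \<le> 1 + 1 / a * 2 ^ q"
        using a card_free_columns_greaterThan_le[of ?N T "m + 1"]
        by (intro one_le_power power_one_plus_le; simp)+
      have "norm (?f T *\<^sub>R x ^ ?B T - x ^ ?B' T) = norm ((?f T - 1) *\<^sub>R x ^ ?B T + (x ^ ?B T - x ^ ?B' T))"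
        by (simp add: algebra_simps)
      also have "\<dots> \<le> \<bar>?f T - 1\<bar> * norm (x ^ ?B T) + norm (x ^ ?B T - x ^ ?B' T)"
        by (metis norm_scaleR norm_triangle_ineq)
      also have "\<dots> \<le> 2 ^ q / a * 1 + 2 * of_bool (?B T \<noteq> ?B' T)"
        using f xB a by (intro add_mono mult_mono norm_power_diff_le x) auto
      finally show ?thesis using 2 nonneg by simp
    next
      case 3
      then obtain i where i: "T (i, m + 1) = Some Alpha" by (auto simp: free_columns_def)
      have "(i, m + 1) \<in> boxes ?N" by (rule staircase_in_boxes[OF T i])
      moreover have "i \<noteq> q + 1" using i 3(1) by auto
      ultimately have "i \<in> {1..q}" by (auto simp: boxes_def)
      then have "of_bool (T (i, m + 1) = Some Alpha \<and> ?D T) \<le>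
          (\<Sum>i\<in>{1..q}. of_bool (T (i, m + 1) = Some Alpha \<and> ?D T) :: real)"
        by (intro member_le_sum) auto
      moreover have "norm (x ^ ?B' T) \<le> 1" using x by (simp add: norm_power power_le_one)
      moreover have "0 \<le> 2 ^ q / a" using a by simp
      ultimately show ?thesis using 3 i by auto
    qed
  qed
  also have "\<dots> = 2 ^ q / a * ?p + (\<Sum>i\<in>{1..q}. expect ?N a b (\<lambda>T. of_bool (T (i, m + 1) = Some Alpha \<and> ?D T)))
      + 2 * expect ?N a b (\<lambda>T. of_bool (?B T \<noteq> ?B' T))"
    by (simp only: expect_add expect_cmult expect_sum)
  \<comment> \<open>The first two errors are multiples of \<open>?p / a\<close>. As
    \<open>?p = (a + q) / ?s\<close> and (a + q) / a <= q + 1, they too are O(1/s) uniformly in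
    \<open>a\<close>.\<close>
  also have "\<dots> \<le> 2 ^ q / a * ?p + (\<Sum>i\<in>{1..q}. ?p / a) + 2 * ((q + 1) * 2 ^ (q + 2) / ?s)"
  proof (intro add_mono sum_mono mult_left_mono order_refl)
    fix i assume "i \<in> {1..q}"
    then show "expect ?N a b (\<lambda>T. of_bool (T (i, m + 1) = Some Alpha \<and> ?D T)) \<le> ?p / a"
      using expect_erase_Alpha[OF pos(4,2), of i "m + 1" ?N "(q + 1, m + 1)"] pos
      by (simp add: field_simps)
  next
    show "expect ?N a b (\<lambda>T. of_bool (?B T \<noteq> ?B' T)) \<le> (q + 1) * 2 ^ (q + 2) / ?s"
      using expect_beta_count_funpow_drop_row[OF a b, of ?k m "q + 1"] by (simp add: algebra_simps)
  qed (use a in auto)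
  also have "\<dots> = (2 ^ q + q) * ((a + q) / a) / ?s + 2 * ((q + 1) * 2 ^ (q + 2) / ?s)"
  proof -
    have *: "2 ^ q / a * y + (\<Sum>i\<in>{1..q}. y / a) = (2 ^ q + q) * (y / a)" for y
      by (simp add: distrib_right add_divide_distrib)
    show ?thesis unfolding * p by (simp add: ac_simps)
  qed
  also have "\<dots> \<le> (2 ^ q + q) * (q + 1) / ?s + 2 * ((q + 1) * 2 ^ (q + 2) / ?s)"
  proof -
    have "(a + q) / a \<le> q + 1"
    proof -
      have "q / a \<le> q / 1" using a by (intro divide_left_mono) auto
      then show ?thesis using a by (simp add: add_divide_distrib)
    qed
    then have "(2 ^ q + q) * ((a + q) / a) \<le> real ((2 ^ q + q) * (q + 1))"
      unfolding of_nat_mult of_nat_add[of "2 ^ q"] of_nat_power of_nat_numeral by (intro mult_left_mono) auto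
    then show ?thesis using s by (intro add_right_mono divide_right_mono) auto
  qed
  also have "\<dots> = ((2 ^ q + q) * (q + 1) + 2 * (q + 1) * 2 ^ (q + 2)) / ?s"
    by (simp add: add_divide_distrib mult.assoc)
  finally have diff: "norm (?\<psi> - ?\<chi>) \<le> ((2 ^ q + q) * (q + 1) + 2 * (q + 1) * 2 ^ (q + 2)) / ?s" .
  have "norm (x - 1) \<le> 2" using norm_triangle_ineq4[of x 1] x by simp
  have r: "(a + q) / ((?s + 1) * ?s) = inverse (?s + 1) * ((a + q) / ?s)"
    by (simp add: divide_inverse ac_simps)
  have "beta_pgf ?k x b (m + q + 2) a - beta_pgf ?k x b ?N (a + 1)
      - (x - 1) * of_real ((a + q) / ((?s + 1) * ?s)) * beta_pgf ?k x b m (a + q) = (x - 1) * ((?\<psi> - ?\<chi>) /\<^sub>R (?s + 1))"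
    unfolding rec \<chi> r scaleR_diff_right by (simp add: scaleR_conv_of_real right_diff_distrib mult.assoc)
  then have "norm (beta_pgf ?k x b (m + q + 2) a - beta_pgf ?k x b ?N (a + 1)
      - (x - 1) * of_real ((a + q) / ((?s + 1) * ?s)) * beta_pgf ?k x b m (a + q))
      = norm (x - 1) * (norm (?\<psi> - ?\<chi>) / (?s + 1))"
    using s by (simp add: norm_mult divide_inverse)
  also have "\<dots> \<le> 2 * (((2 ^ q + q) * (q + 1) + 2 * (q + 1) * 2 ^ (q + 2)) / ?s / (?s + 1))"
    using s diff \<open>norm (x - 1) \<le> 2\<close> by (intro mult_mono divide_right_mono) auto
  also have "\<dots> = 2 * ((2 ^ q + q) * (q + 1) + 2 * (q + 1) * 2 ^ (q + 2)) / ((?s + 1) * ?s)"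
    by (simp add: mult.commute)
  finally show ?thesis .
qed

section \<open>Approximate solution of the recursion\<close>

lemma norm_exp_minus_1_le:
  fixes w :: complex
  assumes "\<bar>Re w\<bar> \<le> 1"
  shows "norm (exp w - 1) \<le> 3 * norm w"
    and "norm (exp w - 1 - w) \<le> 3 * norm w ^ 2"
proof -
  have "exp \<bar>Re w\<bar> \<le> exp 1" using assms by simp
  also have "\<dots> \<le> (3 :: real)" by (rule exp_le)
  finally have e: "exp \<bar>Re w\<bar> \<le> 3" .
  have "norm (exp w - (\<Sum>i\<le>0. w ^ i / fact i)) \<le> exp \<bar>Re w\<bar> * norm w ^ Suc 0 / fact 0"
    by (rule Taylor_exp)
  also have "\<dots> \<le> 3 * norm w" using e by (simp add: mult_right_mono)
  finally show "norm (exp w - 1) \<le> 3 * norm w" by simp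
  have "norm (exp w - (\<Sum>i\<le>1. w ^ i / fact i)) \<le> exp \<bar>Re w\<bar> * norm w ^ Suc 1 / fact 1"
    by (rule Taylor_exp)
  also have "\<dots> \<le> 3 * norm w ^ 2" using e by (simp add: mult_right_mono power2_eq_square)
  finally show "norm (exp w - 1 - w) \<le> 3 * norm w ^ 2" by (simp add: algebra_simps)
qed

context
  fixes z :: complex
  assumes Re_z: "Re z \<le> 0" and norm_z: "norm z \<le> 2"
begin

text \<open>Here \<open>z\<close> stands for x - 1 with x in the closed unit disc, which explains
  the two assumptions of the context.\<close>

lemma norm_exp_nonpos: "0 \<le> h \<Longrightarrow> norm (exp (z * of_real h)) \<le> 1"
  using Re_z by (simp add: mult_nonpos_nonneg)

text \<open>Factor out \<open>exp (z * h')\<close>, of norm at most 1. A gap of at most 1/2 keeps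
  the real part of the remaining exponent within [-1, 1]; the constant is 3 from
  \<open>norm_exp_minus_1_le\<close> times 2 from \<open>norm z\<close>.\<close>

lemma exp_lipschitz:
  assumes "0 \<le> h" "0 \<le> h'" "\<bar>h - h'\<bar> \<le> 1 / 2"
  shows "norm (exp (z * of_real h) - exp (z * of_real h')) \<le> 6 * \<bar>h - h'\<bar>"
proof -
  have w: "norm (z * of_real (h - h')) \<le> 2 * \<bar>h - h'\<bar>"
    using norm_z by (auto simp: norm_mult intro: mult_right_mono simp del: of_real_diff)
  then have "\<bar>Re (z * of_real (h - h'))\<bar> \<le> 1"
    by (rule order_trans[OF abs_Re_le_cmod order_trans]) (use assms(3) in simp)
  then have "norm (exp (z * of_real (h - h')) - 1) \<le> 3 * (2 * \<bar>h - h'\<bar>)"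
    using norm_exp_minus_1_le(1)[of "z * of_real (h - h')"] w by linarith
  then have "norm (exp (z * of_real h')) * norm (exp (z * of_real (h - h')) - 1) \<le> 1 * (6 * \<bar>h - h'\<bar>)"
    using norm_exp_nonpos[OF assms(2)] by (intro mult_mono) auto
  moreover have "exp (z * of_real h) - exp (z * of_real h')
      = exp (z * of_real h') * (exp (z * of_real (h - h')) - 1)"
    by (simp add: algebra_simps flip: exp_add)
  ultimately show ?thesis by (simp add: norm_mult)
qed

lemma exp_second_order:
  assumes "0 \<le> h" "0 \<le> d" "d \<le> 1 / 2"
  shows "norm (exp (z * of_real (h + d)) - exp (z * of_real h) - z * of_real d * exp (z * of_real h)) \<le> 12 * d\<^sup>2"
proof -
  have w: "norm (z * of_real d) \<le> 2 * d"
    using norm_z assms by (auto simp: norm_mult intro: mult_right_mono)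
  then have "\<bar>Re (z * of_real d)\<bar> \<le> 1"
    using abs_Re_le_cmod[of "z * of_real d"] assms by linarith
  then have "norm (exp (z * of_real d) - 1 - z * of_real d) \<le> 3 * norm (z * of_real d) ^ 2"
    by (rule norm_exp_minus_1_le)
  also have "\<dots> \<le> 3 * (2 * d) ^ 2" using w by (intro mult_left_mono power_mono) auto
  finally have "norm (exp (z * of_real h)) * norm (exp (z * of_real d) - 1 - z * of_real d) \<le> 1 * (12 * d\<^sup>2)"
    using norm_exp_nonpos[OF assms(1)] by (intro mult_mono) (auto simp: power2_eq_square)
  moreover have "exp (z * of_real (h + d)) - exp (z * of_real h) - z * of_real d * exp (z * of_real h)
      = exp (z * of_real h) * (exp (z * of_real d) - 1 - z * of_real d)"
    by (simp add: algebra_simps exp_add)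
  ultimately show ?thesis by (simp add: norm_mult)
qed

end

text \<open>Removing a row increases \<open>a\<close> by one and keeps \<open>s = a + b + n\<close>. The profile is chosen such that
  \<open>profile s a - profile s (a + 1)\<close> is \<open>a / s\<^sup>2\<close> up to \<open>O(1 / s\<^sup>2)\<close>, the approximate probability that the
  removed row contributes to the count.\<close>

definition profile :: "real \<Rightarrow> real \<Rightarrow> real" where
  "profile s a = (1 - (a / s)\<^sup>2) / 2"

lemma profile_bounds:
  assumes "0 \<le> a" "a \<le> s"
  shows "0 \<le> profile s a" "profile s a \<le> 1 / 2"
proof -
  have "0 \<le> a / s" "a / s \<le> 1" using assms by (auto simp: divide_le_eq)
  then have "(a / s)\<^sup>2 \<le> 1" by (simp add: power_le_one)
  then show "0 \<le> profile s a" "profile s a \<le> 1 / 2" by (simp_all add: profile_def)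
qed

text \<open>The map from u to (1 - u^2) / 2 is 1-Lipschitz on [0, 1].\<close>

lemma profile_diff_le:
  assumes "0 \<le> a" "a \<le> s" "0 \<le> a'" "a' \<le> s'"
  shows "\<bar>profile s a - profile s' a'\<bar> \<le> \<bar>a / s - a' / s'\<bar>"
proof -
  have *: "0 \<le> a / s" "a / s \<le> 1" "0 \<le> a' / s'" "a' / s' \<le> 1" using assms by (auto simp: divide_le_eq)
  have "(1 - u\<^sup>2) / 2 - (1 - v\<^sup>2) / 2 = (u + v) / 2 * (v - u)" for u v :: real
    by (simp add: power2_eq_square field_simps)
  from this[of "a / s" "a' / s'"]
  have "profile s a - profile s' a' = (a / s + a' / s') / 2 * (a' / s' - a / s)"
    by (simp only: profile_def)
  then have "\<bar>profile s a - profile s' a'\<bar> = \<bar>(a / s + a' / s') / 2\<bar> * \<bar>a' / s' - a / s\<bar>"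
    by (simp only: abs_mult)
  also have "\<dots> = (a / s + a' / s') / 2 * \<bar>a / s - a' / s'\<bar>"
    using * by (simp add: abs_minus_commute)
  also have "\<dots> \<le> 1 * \<bar>a / s - a' / s'\<bar>" using * by (intro mult_right_mono) auto
  finally show ?thesis by simp
qed

text \<open>The proposed solution satisfies the recursion up to O(1/s^2). The second term sits at
  \<open>s - 2\<close> because (a + k - 2) + b + (n - k) = s - 2.\<close>

lemma profile_step:
  fixes z :: complex and k n :: nat and a b s :: real
  assumes z: "Re z \<le> 0" "norm z \<le> 2" and k: "2 \<le> k" "k \<le> n" and a: "1 \<le> a" and b: "0 \<le> b"
    and s: "s = a + b + n" "8 * (k + 5) \<le> s"
  shows "norm (exp (z * profile s (a + 1)) + z * of_real ((a + k - 2) / ((s - 1) * (s - 2))) * exp (z * profile (s - 2) (a + k - 2))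
      - exp (z * profile s a)) \<le> (48 + 52 * (k + 5)) / s\<^sup>2"
proof -
  define c where "c = (a + k - 2) / ((s - 1) * (s - 2))"
  \<comment> \<open>The exact increment of the profile from \<open>a + 1\<close> to
    \<open>a\<close>. It shares its leading term \<open>a / s^2\<close> with the coefficient
    \<open>c\<close>.\<close>
  define d where "d = (2 * a + 1) / (2 * s\<^sup>2)"
  have s8: "56 \<le> s" using s k by simp
  have as: "a + k \<le> s" "a \<le> s" "k \<le> s" using s a b k by auto
  have d: "profile s a = profile s (a + 1) + d"
    using s8 by (simp add: profile_def d_def power2_eq_square field_simps)
  have d2: "0 \<le> d" "d \<le> 2 / s"
  proof -
    show "0 \<le> d" using a by (simp add: d_def)
    have "d \<le> (4 * s) / (2 * s\<^sup>2)" unfolding d_def using as a by (intro divide_right_mono) auto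
    also have "\<dots> = 2 / s" using s8 by (simp add: power2_eq_square)
    finally show "d \<le> 2 / s" .
  qed
  have "2 / s \<le> 1 / 2" using s8 by simp
  then have d3: "d \<le> 1 / 2" using d2 by linarith
  have nn: "0 \<le> profile s (a + 1)" "0 \<le> profile (s - 2) (a + k - 2)" "profile s (a + 1) \<le> 1/2" "profile (s - 2) (a + k - 2) \<le> 1/2"
    by (rule profile_bounds; use a as k in simp)+
  have e1: "norm (exp (z * of_real (profile s a)) - exp (z * of_real (profile s (a + 1)))
      - z * of_real d * exp (z * of_real (profile s (a + 1)))) \<le> 48 / s\<^sup>2"
  proof -
    have "12 * d\<^sup>2 \<le> 12 * (2 / s)\<^sup>2" using d2 by (intro mult_left_mono power_mono) auto
    also have "\<dots> = 48 / s\<^sup>2" by (simp add: power_divide)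
    finally show ?thesis
      unfolding d using exp_second_order[OF z nn(1) d2(1) d3] by linarith
  qed
  have s12: "s\<^sup>2 \<le> 2 * ((s - 1) * (s - 2))"
  proof -
    have "0 \<le> s * (s - 6)" using s8 by simp
    then show ?thesis by (simp add: power2_eq_square algebra_simps)
  qed
  have pos: "0 < (s - 1) * (s - 2)" using s8 by simp
  have inv: "1 / ((s - 1) * (s - 2)) \<le> 2 / s\<^sup>2"
    using s12 pos s8 by (simp add: divide_simps)
  have c: "0 \<le> c" "c \<le> 2 / s"
  proof -
    show "0 \<le> c" using a k pos by (simp add: c_def)
    have "c \<le> (s - 2) / ((s - 1) * (s - 2))" unfolding c_def using as pos by (intro divide_right_mono) auto
    also have "\<dots> = 1 / (s - 1)" using s8 by simp
    also have "\<dots> \<le> 2 / s" using s8 by (simp add: divide_simps)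
    finally show "c \<le> 2 / s" .
  qed
  have cd: "\<bar>c - d\<bar> \<le> 2 * (k + 5) / s\<^sup>2"
  proof -
    \<comment> \<open>Both \<open>c\<close> and \<open>d\<close> are compared with their common
      leading term, so that c - d = e - t with \<open>e\<close> and \<open>t\<close> nonnegative and
      O(1/s^2).\<close>
    define e t where "e = c - a / s\<^sup>2" and "t = 1 / 2 / s\<^sup>2"
    have e: "e = ((k - 2) * s\<^sup>2 + a * (3 * s - 2)) / (s\<^sup>2 * ((s - 1) * (s - 2)))"
    proof -
      have "(a + k - 2) * s\<^sup>2 - a * ((s - 1) * (s - 2)) = (k - 2) * s\<^sup>2 + a * (3 * s - 2)"
        using k by (simp add: of_nat_diff power2_eq_square algebra_simps)
      then show ?thesis unfolding c_def e_def using pos s8 by (subst diff_frac_eq) (auto simp: mult.commute)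
    qed
    have "0 \<le> e"
      unfolding e using k a s8 pos by (intro divide_nonneg_nonneg add_nonneg_nonneg mult_nonneg_nonneg) auto
    have "e \<le> (k + 1) * s\<^sup>2 / (s\<^sup>2 * ((s - 1) * (s - 2)))"
      unfolding e
    proof (intro divide_right_mono)
      have "a * (3 * s - 2) \<le> s * (3 * s)" using as a s8 by (intro mult_mono) auto
      then show "(k - 2) * s\<^sup>2 + a * (3 * s - 2) \<le> (k + 1) * s\<^sup>2"
        using k by (simp add: of_nat_diff power2_eq_square algebra_simps)
    qed (use pos s8 in auto)
    also have "\<dots> = (k + 1) * (1 / ((s - 1) * (s - 2)))" using s8 by simp
    also have "\<dots> \<le> (k + 1) * (2 / s\<^sup>2)" using inv by (intro mult_left_mono) auto
    finally have "e \<le> (k + 1) * (2 / s\<^sup>2)" .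
    moreover have "c - d = e - t" by (simp add: e_def t_def d_def add_divide_distrib)
    moreover have "0 \<le> t" by (simp add: t_def)
    moreover have "(k + 1) * (2 / s\<^sup>2) + t \<le> 2 * (k + 5) / s\<^sup>2"
      unfolding t_def using s8 by (simp add: divide_simps)
    ultimately show ?thesis using \<open>0 \<le> e\<close> unfolding abs_le_iff by linarith
  qed
  have pr: "\<bar>profile (s - 2) (a + k - 2) - profile s (a + 1)\<bar> \<le> 2 * (k + 5) / s"
  proof -
    have "\<bar>profile (s - 2) (a + k - 2) - profile s (a + 1)\<bar> \<le> \<bar>(a + k - 2) / (s - 2) - (a + 1) / s\<bar>"
      using a as k by (intro profile_diff_le) auto
    also have "(a + k - 2) / (s - 2) - (a + 1) / s = ((real k - 3) * s + 2 * a + 2) / ((s - 2) * s)"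
      using s8 by (subst diff_frac_eq) (auto simp: algebra_simps)
    also have "\<bar>\<dots>\<bar> \<le> (k + 5) * s / ((s - 2) * s)"
    proof -
      have "\<bar>(real k - 3) * s + 2 * a + 2\<bar> \<le> (k + 5) * s"
      proof -
        have "2 * s \<le> k * s" using k s8 by (intro mult_right_mono) auto
        then show ?thesis using as a s8 by (auto simp: abs_if algebra_simps)
      qed
      then show ?thesis unfolding abs_divide using s8 by (intro frac_le) auto
    qed
    also have "\<dots> = (k + 5) * (1 / (s - 2))" using s8 by simp
    also have "\<dots> \<le> (k + 5) * (2 / s)" using s8 by (intro mult_left_mono) (auto simp: divide_simps)
    finally show ?thesis by (simp add: mult.commute)
  qed
  \<comment> \<open>The lower bound on \<open>s\<close> provides the gap of at most 1/2 that
    \<open>exp_lipschitz\<close> requires.\<close>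
  have half: "2 * (k + 5) / s \<le> 1 / 2" using s s8 by (simp add: divide_simps)
  have "norm (exp (z * of_real (profile (s - 2) (a + k - 2))) - exp (z * of_real (profile s (a + 1))))
      \<le> 6 * (2 * (k + 5) / s)"
    by (rule order_trans[OF exp_lipschitz[OF z nn(2,1) order_trans[OF pr half]]]) (rule mult_left_mono[OF pr], simp)
  then have e2: "c * norm (exp (z * of_real (profile (s - 2) (a + k - 2))) - exp (z * of_real (profile s (a + 1))))
      \<le> 2 / s * (6 * (2 * (k + 5) / s))"
    using c s8 by (intro mult_mono) auto
  have e3: "\<bar>c - d\<bar> * norm (exp (z * of_real (profile s (a + 1)))) \<le> 2 * (k + 5) / s\<^sup>2 * 1"
    using cd norm_exp_nonpos[OF z nn(1)] by (intro mult_mono) auto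
  let ?g = "exp (z * of_real (profile s a))" and ?g1 = "exp (z * of_real (profile s (a + 1)))"
    and ?g2 = "exp (z * of_real (profile (s - 2) (a + k - 2)))"
  \<comment> \<open>The three differences are the shift of the profile in the second term, the error
    in the coefficient, and the Taylor remainder. They contribute 48 (k + 5), 4 (k + 5) and 48 over
    s^2.\<close>
  have "?g1 + z * c * ?g2 - ?g = z * (c * (?g2 - ?g1)) + z * ((c - d) * ?g1) - (?g - ?g1 - z * d * ?g1)"
    by (simp add: algebra_simps)
  also have "norm \<dots> \<le> norm (z * (c * (?g2 - ?g1))) + norm (z * ((c - d) * ?g1)) + norm (?g - ?g1 - z * d * ?g1)"
    by (meson add_mono_thms_linordered_semiring(3) norm_triangle_ineq norm_triangle_ineq4 order_trans)
  also have "\<dots> \<le> 2 * (2 / s * (6 * (2 * (k + 5) / s))) + 2 * (2 * (k + 5) / s\<^sup>2) + 48 / s\<^sup>2"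
  proof (intro add_mono e1)
    show "norm (z * (c * (?g2 - ?g1))) \<le> 2 * (2 / s * (6 * (2 * (k + 5) / s)))"
    proof -
      have "norm (z * (c * (?g2 - ?g1))) = norm z * (c * norm (?g2 - ?g1))" using c by (simp add: norm_mult)
      also have "\<dots> \<le> 2 * (2 / s * (6 * (2 * (k + 5) / s)))" using z c by (intro mult_mono e2) auto
      finally show ?thesis .
    qed
    show "norm (z * ((c - d) * ?g1)) \<le> 2 * (2 * (k + 5) / s\<^sup>2)"
      unfolding norm_mult using z e3 by (intro mult_mono) (auto simp flip: of_real_diff)
  qed
  also have "\<dots> = (48 + 52 * (k + 5)) / s\<^sup>2"
    using s8 by (simp add: field_simps power2_eq_square)
  finally show ?thesis by (simp add: c_def)
qed

text \<open>From exp y >= 1 + y and (1 + y)(1 - y/2) >= 1. It converts the exponential weight of the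
  induction below into a linear gain.\<close>

lemma exp_minus_le:
  fixes y :: real
  assumes "0 \<le> y" "y \<le> 1"
  shows "exp (- y) \<le> 1 - y / 2"
proof -
  have "0 \<le> y * (1 - y)" using assms by simp
  then have "1 \<le> (1 + y) * (1 - y / 2)" by (simp add: algebra_simps)
  also have "\<dots> \<le> exp y * (1 - y / 2)" using assms exp_ge_add_one_self[of y] by (intro mult_right_mono) auto
  finally show ?thesis by (simp add: exp_minus inverse_eq_divide divide_le_eq mult.commute)
qed

text \<open>A discrete Gronwall argument: the proposed solution satisfies the same recursion up to
  errors of the same order, and the difference is controlled by strong induction on \<open>n\<close>
  for all \<open>a\<close> simultaneously.\<close>

lemma recursion_bound:
  fixes \<phi> :: "nat \<Rightarrow> real \<Rightarrow> complex" and z :: complex and k :: nat and b C :: real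
  assumes z: "Re z \<le> 0" "norm z \<le> 2" and k: "2 \<le> k" and b: "0 \<le> b" and C: "0 \<le> C"
    and bounded: "\<And>n a. 1 \<le> a \<Longrightarrow> norm (\<phi> n a) \<le> 1"
    and base: "\<And>n a. n < k \<Longrightarrow> 1 \<le> a \<Longrightarrow> \<phi> n a = 1"
    and step: "\<And>n a. k \<le> n \<Longrightarrow> 1 \<le> a \<Longrightarrow>
      norm (\<phi> n a - \<phi> (n - 1) (a + 1)
        - z * of_real ((a + k - 2) / ((a + b + n - 1) * (a + b + n - 2))) * \<phi> (n - k) (a + k - 2))
      \<le> C / ((a + b + n - 1) * (a + b + n - 2))"
  shows "\<exists>K. \<forall>n a. 1 \<le> a \<longrightarrow> norm (\<phi> n a - exp (z * of_real (profile (a + b + n) a))) \<le> K / (a + b + n)"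
proof -
  \<comment> \<open>The threshold for \<open>s\<close> from which \<open>profile_step\<close>
    applies.\<close>
  define L :: real where "L = 8 * (k + 5)"
  define C4 where "C4 = 2 * C + (48 + 52 * (k + 5))"
  \<comment> \<open>The summands serve the trivial bound 2 for s < L, the local error
    \<open>C4 / s^2\<close>, and the base case n < k, in this order.\<close>
  define K where "K = 2 * L + C4 + 6 * (k + b)"
  have L: "56 \<le> L" using k by (simp add: L_def)
  have K: "2 * L \<le> K" "C4 \<le> K" "6 * (k + b) \<le> K" "0 < K" "0 \<le> C4"
    using L C b by (simp_all add: K_def C4_def)
  define g where "g n a = exp (z * of_real (profile (a + b + real n) a))" for n :: nat and a :: real
  \<comment> \<open>The exponential pays for the term at size n - k, and it is harmless in the end
    because n <= s bounds it by exp 14.\<close>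
  have claim: "norm (\<phi> n a - g n a) \<le> K * exp (14 * real n / (a + b + n)) / (a + b + n)" if "1 \<le> a" for n a
    using that
  proof (induction n arbitrary: a rule: less_induct)
    case (less n)
    define s where "s = a + b + n"
    have a: "1 \<le> a" by (rule less.prems)
    have s: "1 \<le> s" "a \<le> s" using a b by (auto simp: s_def)
    have h: "0 \<le> profile s a" "profile s a \<le> 1 / 2" by (rule profile_bounds; use a s in simp)+
    have one: "K / s \<le> K * exp (14 * real n / s) / s"
      using K s by (intro divide_right_mono) auto
    show ?case
    proof (cases "n < k")
      case True
      \<comment> \<open>For n < k the ratio a / s differs from 1 by (b + n) / s only, and the
        profile vanishes at ratio 1, so the proposed solution is within O(1/s) of the true value
        1.\<close>
      have "profile s a = profile s a - profile s s" using s by (simp add: profile_def)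
      then have "profile s a \<le> \<bar>a / s - s / s\<bar>"
        using profile_diff_le[of a s s s] a s by simp
      also have "a / s - s / s = - ((b + n) / s)"
      proof -
        have "a - s = - (b + n)" by (simp add: s_def)
        then show ?thesis by (simp only: diff_divide_distrib[symmetric] minus_divide_left)
      qed
      also have "\<bar>\<dots>\<bar> = (b + n) / s" using s b by simp
      also have "\<dots> \<le> (k + b) / s" using True s by (intro divide_right_mono) auto
      finally have "6 * profile s a \<le> K / s" using K s by (simp add: field_simps)
      moreover have "norm (exp (z * of_real 0) - g n a) \<le> 6 * \<bar>0 - profile s a\<bar>"
        unfolding g_def s_def[symmetric] using h by (intro exp_lipschitz z) auto
      ultimately show ?thesis using one h base[OF True a] by (simp add: s_def)
    next
      case False
      then have n: "k \<le> n" by simp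
      show ?thesis
      proof (cases "s < L")
        case True
        have "norm (\<phi> n a - g n a) \<le> 2"
          using norm_triangle_ineq4[of "\<phi> n a" "g n a"] bounded[OF a, of n] norm_exp_nonpos[OF z h(1)]
          unfolding g_def s_def by linarith
        also have "2 \<le> K / s" using True K s by (simp add: le_divide_eq)
        finally show ?thesis using one unfolding s_def by linarith
      next
        case False
        have s56: "56 \<le> s" using False L by simp
        let ?E = "exp (14 * real n / s)"
        define c where "c = (a + k - 2) / ((s - 1) * (s - 2))"
        have sub: "a + 1 + b + real (n - 1) = s" "a + k - 2 + b + real (n - k) = s - 2"
          using n k by (simp_all add: s_def of_nat_diff)
        have as: "a + k \<le> s" using n b by (simp add: s_def)
        have pos: "0 < (s - 1) * (s - 2)" using s56 by simp
        have inv: "1 / ((s - 1) * (s - 2)) \<le> 2 / s\<^sup>2"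
        proof -
          have "0 \<le> s * (s - 6)" using s56 by simp
          then have "s\<^sup>2 \<le> 2 * ((s - 1) * (s - 2))" by (simp add: power2_eq_square algebra_simps)
          then show ?thesis using pos s56 by (simp add: divide_simps)
        qed
        have c: "0 \<le> c" "c \<le> 1 / (s - 1)"
        proof -
          show "0 \<le> c" using a k pos by (simp add: c_def)
          have "c \<le> (s - 2) / ((s - 1) * (s - 2))" unfolding c_def using as pos by (intro divide_right_mono) auto
          then show "c \<le> 1 / (s - 1)" using s56 by simp
        qed
        \<comment> \<open>This call keeps \<open>s\<close> and lowers \<open>n\<close> by one, which
          gains the factor exp (-14/s) <= 1 - 7/s.\<close>
        have t1: "norm (\<phi> (n - 1) (a + 1) - g (n - 1) (a + 1)) \<le> K * ?E / s - 7 * (K * ?E / s\<^sup>2)"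
        proof -
          have "norm (\<phi> (n - 1) (a + 1) - g (n - 1) (a + 1)) \<le> K * exp (14 * real (n - 1) / s) / s"
            using less.IH[of "n - 1" "a + 1"] n k a unfolding sub by simp
          also have "14 * real (n - 1) / s = 14 * real n / s + - (14 / s)"
            using n k by (simp add: of_nat_diff diff_divide_distrib right_diff_distrib)
          also have "exp \<dots> = ?E * exp (- (14 / s))" by (rule exp_add)
          also have "K * (?E * exp (- (14 / s))) / s \<le> K * (?E * (1 - 14 / s / 2)) / s"
            using K s s56 by (intro divide_right_mono mult_left_mono exp_minus_le) auto
          also have "\<dots> = K * ?E / s - 7 * (K * ?E / s\<^sup>2)"
            using s by (simp add: field_simps power2_eq_square)
          finally show ?thesis .
        qed
        have t2: "norm (z * of_real c * (\<phi> (n - k) (a + k - 2) - g (n - k) (a + k - 2))) \<le> 4 * (K * ?E / s\<^sup>2)"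
        proof -
          have "norm (\<phi> (n - k) (a + k - 2) - g (n - k) (a + k - 2)) \<le> K * exp (14 * real (n - k) / (s - 2)) / (s - 2)"
            using less.IH[of "n - k" "a + k - 2"] n k a unfolding sub by simp
          also have "\<dots> \<le> K * ?E / (s - 2)"
          proof -
            \<comment> \<open>By k >= 2 and n <= s, the exponential of the smaller instance does not
              exceed \<open>?E\<close>, although its denominator is smaller.\<close>
            have "real (n - k) / (s - 2) \<le> real n / s"
            proof -
              have "real n \<le> s" using a b by (simp add: s_def)
              moreover have "(real n - real k) * s \<le> (real n - 2) * s" using k s by (intro mult_right_mono) auto
              ultimately have "real (n - k) * s \<le> real n * (s - 2)"
                using n by (simp add: of_nat_diff algebra_simps)
              then show ?thesis using s56 by (simp add: divide_simps)
            qed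
            then have "14 * real (n - k) / (s - 2) \<le> 14 * real n / s" by simp
            then show ?thesis using K s56 by (intro divide_right_mono mult_left_mono) auto
          qed
          finally have *: "norm (\<phi> (n - k) (a + k - 2) - g (n - k) (a + k - 2)) \<le> K * ?E / (s - 2)" .
          have "norm z * c * norm (\<phi> (n - k) (a + k - 2) - g (n - k) (a + k - 2))
              \<le> 2 * (1 / (s - 1)) * (K * ?E / (s - 2))"
            using z c * s56 by (intro mult_mono) auto
          also have "\<dots> = 2 * (K * ?E) * (1 / ((s - 1) * (s - 2)))" by simp
          also have "\<dots> \<le> 2 * (K * ?E) * (2 / s\<^sup>2)" using K by (intro mult_left_mono inv) auto
          finally show ?thesis using c by (simp add: norm_mult)
        qed
        have t3: "norm (\<phi> n a - \<phi> (n - 1) (a + 1) - z * of_real c * \<phi> (n - k) (a + k - 2)) \<le> 2 * C / s\<^sup>2"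
        proof -
          have "C * (1 / ((s - 1) * (s - 2))) \<le> C * (2 / s\<^sup>2)" using C by (intro mult_left_mono inv)
          then show ?thesis using step[OF n a] unfolding c_def s_def by (simp add: mult.commute)
        qed
        have t4: "norm (g (n - 1) (a + 1) + z * of_real c * g (n - k) (a + k - 2) - g n a)
            \<le> (48 + 52 * (k + 5)) / s\<^sup>2"
          unfolding g_def sub c_def s_def[symmetric]
          using False by (intro profile_step[OF z k n a b s_def]) (simp add: L_def)
        have "\<phi> n a - g n a = (\<phi> n a - \<phi> (n - 1) (a + 1) - z * of_real c * \<phi> (n - k) (a + k - 2))
            + (\<phi> (n - 1) (a + 1) - g (n - 1) (a + 1))
            + z * of_real c * (\<phi> (n - k) (a + k - 2) - g (n - k) (a + k - 2))
            + (g (n - 1) (a + 1) + z * of_real c * g (n - k) (a + k - 2) - g n a)"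
          by (simp add: algebra_simps)
        also have "norm \<dots> \<le> 2 * C / s\<^sup>2 + (K * ?E / s - 7 * (K * ?E / s\<^sup>2)) + 4 * (K * ?E / s\<^sup>2)
            + (48 + 52 * (k + 5)) / s\<^sup>2"
          by (intro norm_triangle_mono t1 t2 t3 t4)
        also have "\<dots> = K * ?E / s + C4 / s\<^sup>2 - 3 * (K * ?E / s\<^sup>2)"
          by (simp add: C4_def add_divide_distrib)
        \<comment> \<open>Of the gain 7 from \<open>t1\<close>, \<open>t2\<close> consumes 4; the
          remaining 3 dominate the local error because C4 <= K.\<close>
        also have "\<dots> \<le> K * ?E / s"
        proof -
          have "K * 1 \<le> K * ?E" using K s by (intro mult_left_mono) auto
          then have "C4 \<le> K * ?E" using K by linarith
          then have "C4 / s\<^sup>2 \<le> K * ?E / s\<^sup>2" by (rule divide_right_mono) simp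
          moreover have "0 \<le> K * ?E / s\<^sup>2" using K by simp
          ultimately show ?thesis by linarith
        qed
        finally show ?thesis by (simp add: s_def)
      qed
    qed
  qed
  have "norm (\<phi> n a - g n a) \<le> K * exp 14 / (a + b + n)" if "1 \<le> a" for n a
  proof -
    have "14 * real n / (a + b + n) \<le> 14" using that b by (simp add: divide_le_eq)
    then have "K * exp (14 * real n / (a + b + n)) / (a + b + n) \<le> K * exp 14 / (a + b + n)"
      using that b K by (intro divide_right_mono mult_left_mono) auto
    then show ?thesis using claim[OF that, of n] by linarith
  qed
  then show ?thesis unfolding g_def by blast
qed

section \<open>Convergence\<close>

lemma beta_pgf_error:
  assumes x: "norm x \<le> 1" and k: "2 \<le> k" and b: "0 \<le> b"
  shows "\<exists>K. \<forall>n a. 1 \<le> a \<longrightarrow>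
    norm (beta_pgf k x b n a - exp ((x - 1) * of_real (profile (a + b + n) a))) \<le> K / (a + b + n)"
proof -
  obtain q where q: "k = q + 2" using k by (metis le_iff_add add.commute)
  define C :: real where "C = real (2 * ((2 ^ q + q) * (q + 1) + 2 * (q + 1) * 2 ^ (q + 2)))"
  have z: "Re (x - 1) \<le> 0" "norm (x - 1) \<le> 2"
    using complex_Re_le_cmod[of x] norm_triangle_ineq4[of x 1] x by auto
  show ?thesis
  proof (rule recursion_bound[OF z k b, where C = C])
    fix n a assume n: "k \<le> n" and a: "(1::real) \<le> a"
    then obtain m where m: "n = m + k" by (metis le_iff_add add.commute)
    have s: "a + b + real n - 1 = a + b + m + q + 1" "a + b + real n - 2 = a + b + m + q" "a + real k - 2 = a + q"
      "n - 1 = m + q + 1" "n - k = m" "n = m + q + 2"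
      by (simp_all add: m q)
    show "norm (beta_pgf k x b n a - beta_pgf k x b (n - 1) (a + 1)
        - (x - 1) * of_real ((a + k - 2) / ((a + b + n - 1) * (a + b + n - 2))) * beta_pgf k x b (n - k) (a + k - 2))
      \<le> C / ((a + b + n - 1) * (a + b + n - 2))"
      unfolding s(1-5) unfolding s(6) unfolding q C_def by (rule beta_pgf_step[OF x a b])
  qed (use x b in \<open>auto simp: C_def intro: norm_beta_pgf_le beta_pgf_less\<close>)
qed

lemma beta_pgf_tendsto:
  assumes x: "norm x \<le> 1" and k: "2 \<le> k" and b: "0 \<le> b" and a: "1 \<le> a"
  shows "(\<lambda>n. beta_pgf k x b n a) \<longlonglongrightarrow> exp ((x - 1) / 2)"
proof -
  obtain K where K: "norm (beta_pgf k x b n a - exp ((x - 1) * of_real (profile (a + b + n) a))) \<le> K / (a + b + n)" for n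
    using beta_pgf_error[OF x k b] a by blast
  have inf: "filterlim (\<lambda>n. a + b + real n) at_infinity sequentially"
    by (intro filterlim_at_top_imp_at_infinity filterlim_tendsto_add_at_top[OF tendsto_const] filterlim_real_sequentially)
  have "(\<lambda>n. (1 - (a / (a + b + real n))\<^sup>2) / 2) \<longlonglongrightarrow> (1 - 0\<^sup>2) / 2"
    by (intro tendsto_intros tendsto_divide_0[OF tendsto_const] inf) auto
  then have lim: "(\<lambda>n. profile (a + b + n) a) \<longlonglongrightarrow> (1 - 0\<^sup>2) / 2" by (simp only: profile_def)
  have "(\<lambda>n. exp ((x - 1) * of_real (profile (a + b + n) a))) \<longlonglongrightarrow> exp ((x - 1) * of_real ((1 - 0\<^sup>2) / 2))"
    by (intro tendsto_intros lim)
  moreover have "(\<lambda>n. beta_pgf k x b n a - exp ((x - 1) * of_real (profile (a + b + n) a))) \<longlonglongrightarrow> 0"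
  proof (rule Lim_null_comparison[OF always_eventually])
    show "\<forall>n. norm (beta_pgf k x b n a - exp ((x - 1) * of_real (profile (a + b + n) a))) \<le> K / (a + b + n)"
      using K by blast
    show "(\<lambda>n. K / (a + b + real n)) \<longlonglongrightarrow> 0" by (rule tendsto_divide_0[OF tendsto_const inf])
  qed
  ultimately have "(\<lambda>n. (beta_pgf k x b n a - exp ((x - 1) * of_real (profile (a + b + n) a))) +
      exp ((x - 1) * of_real (profile (a + b + n) a))) \<longlonglongrightarrow> 0 + exp ((x - 1) * of_real ((1 - 0\<^sup>2) / 2))"
    by (intro tendsto_add)
  then show ?thesis by simp
qed

section \<open>From finite and infinite symbol weights to the dual parameters\<close>

lemma weight_eq_dual_weight:
  assumes "S \<in> staircase_tableaux n" "0 < u" "0 < v"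
  shows "weight u v S = u ^ n * v ^ n * dual_weight (1 / u) (1 / v) n S"
proof -
  have "num_symbol Alpha S \<le> n" "num_symbol Beta S \<le> n"
    using card_free_columns[OF assms(1)] num_symbol_beta_le[OF assms(1)] by simp_all
  then have "u ^ n = u ^ num_symbol Alpha S * u ^ (n - num_symbol Alpha S)"
    "v ^ n = v ^ num_symbol Beta S * v ^ (n - num_symbol Beta S)"
    by (simp_all flip: power_add)
  then show ?thesis using assms by (simp add: weight_def dual_weight_def power_divide)
qed

lemma finite_prob_eq_dual_weight:
  assumes "S \<in> staircase_tableaux n" "0 < u" "0 < v"
  shows "finite_prob n u v S = dual_weight (1 / u) (1 / v) n S / pochhammer (1 / u + 1 / v) n"
proof -
  have "partition_function n u v = u ^ n * v ^ n * pochhammer (1 / u + 1 / v) n"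
    using assms weighted_sum_1[of n "1 / u" "1 / v"]
    by (simp add: partition_function_def weight_eq_dual_weight weighted_sum_def flip: sum_distrib_left)
  then show ?thesis using assms by (simp add: finite_prob_def weight_eq_dual_weight)
qed

lemma tendsto_pochhammer:
  fixes f :: "'a \<Rightarrow> real"
  assumes "(f \<longlongrightarrow> c) F"
  shows "((\<lambda>t. pochhammer (f t) n) \<longlongrightarrow> pochhammer c n) F"
  unfolding pochhammer_prod by (intro tendsto_intros assms)

lemma tendsto_dual_weight:
  assumes "(f \<longlongrightarrow> a) F" "(g \<longlongrightarrow> b) F"
  shows "((\<lambda>t. dual_weight (f t) (g t) n S) \<longlongrightarrow> dual_weight a b n S) F"
  unfolding dual_weight_def by (intro tendsto_intros assms)

text \<open>This covers a single infinite weight: one of \<open>a\<close>, \<open>b\<close> stays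
  positive in the limit, so the normaliser does not vanish there.\<close>

lemma tendsto_finite_prob:
  assumes pos: "\<forall>\<^sub>F t in F. 0 < u t \<and> 0 < v t"
    and lim: "((\<lambda>t. 1 / u t) \<longlongrightarrow> a) F" "((\<lambda>t. 1 / v t) \<longlongrightarrow> b) F" and ab: "0 < a + b"
  shows "\<exists>L. ((\<lambda>t. finite_prob n (u t) (v t) S) \<longlongrightarrow> L) F"
proof (cases "S \<in> staircase_tableaux n")
  case True
  have "((\<lambda>t. dual_weight (1 / u t) (1 / v t) n S / pochhammer (1 / u t + 1 / v t) n) \<longlongrightarrow>
      dual_weight a b n S / pochhammer (a + b) n) F"
    using pochhammer_pos[OF ab, of n]
    by (intro tendsto_divide tendsto_dual_weight tendsto_pochhammer tendsto_add lim) simp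
  moreover have "\<forall>\<^sub>F t in F. dual_weight (1 / u t) (1 / v t) n S / pochhammer (1 / u t + 1 / v t) n =
      finite_prob n (u t) (v t) S"
    using pos by eventually_elim (simp add: finite_prob_eq_dual_weight[OF True])
  ultimately show ?thesis by (intro exI) (rule Lim_transform_eventually)
qed (auto simp: finite_prob_def)

text \<open>Every tableau has a column without \<open>\<alpha>\<close> or a row without \<open>\<beta>\<close>. The corresponding factor of the dual
  weight cancels the factor of \<open>pochhammer\<close> that vanishes at \<open>0\<close>.\<close>

lemma tendsto_finite_prob_diagonal:
  "\<exists>L. ((\<lambda>t. finite_prob (Suc m) t t S) \<longlongrightarrow> L) at_top"
proof (cases "S \<in> staircase_tableaux (Suc m)")
  case True
  define d where "d = (Suc m - num_symbol Alpha S) + (Suc m - num_symbol Beta S)"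
  obtain e where e: "d = Suc e"
    using num_symbols_le[OF True] by (cases d) (auto simp: d_def)
  have lim: "((\<lambda>t::real. 1 / t) \<longlongrightarrow> 0) at_top" by real_asymp
  have "((\<lambda>t::real. (1 / t) ^ e / (2 * pochhammer (1 / t + 1 / t + 1) m)) \<longlongrightarrow>
      0 ^ e / (2 * pochhammer (0 + 0 + 1) m)) at_top"
    using pochhammer_pos[of "1 :: real" m]
    by (intro tendsto_divide tendsto_pochhammer tendsto_add tendsto_mult tendsto_const tendsto_power lim) simp
  moreover have "\<forall>\<^sub>F t in at_top. (1 / t) ^ e / (2 * pochhammer (1 / t + 1 / t + 1) m) = finite_prob (Suc m) t t S"
    using eventually_gt_at_top[of "0 :: real"]
  proof eventually_elim
    case (elim t)
    have "finite_prob (Suc m) t t S = (1 / t) ^ d / pochhammer (1 / t + 1 / t) (Suc m)"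
      using elim by (simp add: finite_prob_eq_dual_weight[OF True] dual_weight_def d_def power_add)
    also have "\<dots> = (1 / t) * (1 / t) ^ e / ((1 / t) * (2 * pochhammer (1 / t + 1 / t + 1) m))"
      by (simp add: e pochhammer_rec)
    also have "\<dots> = (1 / t) ^ e / (2 * pochhammer (1 / t + 1 / t + 1) m)"
      using elim by (intro mult_divide_mult_cancel_left) simp
    finally show ?case by simp
  qed
  ultimately show ?thesis by (intro exI) (rule Lim_transform_eventually)
qed (auto simp: finite_prob_def)

text \<open>All four cases become limits along curves of positive finite weights, constant where the
  weight is finite. Existence of each limit has to be shown, as \<open>Lim\<close> carries no
  information otherwise.\<close>

lemma tableau_prob_limit:
  assumes "0 < \<alpha>" "0 < \<beta>"
  shows "\<exists>u v :: real \<Rightarrow> real. (\<forall>\<^sub>F t in at_top. 0 < u t \<and> 0 < v t) \<and>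
    ((\<lambda>t. 1 / u t) \<longlongrightarrow> enn2real (inverse \<alpha>)) at_top \<and> ((\<lambda>t. 1 / v t) \<longlongrightarrow> enn2real (inverse \<beta>)) at_top \<and>
    (\<forall>S. ((\<lambda>t. finite_prob (Suc m) (u t) (v t) S) \<longlongrightarrow> tableau_prob (Suc m) \<alpha> \<beta> S) at_top)"
proof -
  have I: ?thesis if "\<forall>\<^sub>F t in at_top. 0 < u t \<and> 0 < v t"
    "((\<lambda>t. 1 / u t) \<longlongrightarrow> enn2real (inverse \<alpha>)) at_top" "((\<lambda>t. 1 / v t) \<longlongrightarrow> enn2real (inverse \<beta>)) at_top"
    "\<And>S. ((\<lambda>t. finite_prob (Suc m) (u t) (v t) S) \<longlongrightarrow> tableau_prob (Suc m) \<alpha> \<beta> S) at_top"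
    for u v :: "real \<Rightarrow> real" using that by blast
  have fin: "\<exists>c > 0. \<gamma> = ennreal c \<and> enn2real \<gamma> = c \<and> enn2real (inverse \<gamma>) = 1 / c" if \<gamma>: "0 < \<gamma>" "\<gamma> \<noteq> top" for \<gamma> :: ennreal
  proof -
    obtain c where "0 \<le> c" "\<gamma> = ennreal c" using \<gamma> by (cases \<gamma>) auto
    with \<gamma> show ?thesis by (auto simp: inverse_ennreal inverse_eq_divide)
  qed
  have inv_top: "enn2real (inverse (top :: ennreal)) = 0" by simp
  have lim: "((\<lambda>t::real. 1 / t) \<longlongrightarrow> 0) at_top" by real_asymp
  note gt = eventually_gt_at_top[of "0 :: real"]
  have Lim: "(f \<longlongrightarrow> Lim at_top f) at_top" if "\<exists>L. (f \<longlongrightarrow> L) at_top" for f :: "real \<Rightarrow> real"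
    using that tendsto_Lim[OF trivial_limit_at_top_linorder] by metis
  show ?thesis
  proof (cases "\<alpha> = top"; cases "\<beta> = top")
    assume "\<alpha> = top" "\<beta> = top"
    then show ?thesis
      using lim gt by (intro I[of "\<lambda>t. t" "\<lambda>t. t"]) (auto simp: tableau_prob_def intro: Lim tendsto_finite_prob_diagonal)
  next
    assume \<alpha>: "\<alpha> = top" and "\<beta> \<noteq> top"
    then obtain c where c: "0 < c" "\<beta> = ennreal c" "enn2real \<beta> = c" "enn2real (inverse \<beta>) = 1 / c"
      using fin assms by blast
    have "\<exists>L. ((\<lambda>t. finite_prob (Suc m) t c S) \<longlongrightarrow> L) at_top" for S
      using c gt lim by (intro tendsto_finite_prob[where a = 0 and b = "1 / c"]) auto
    then show ?thesis
      using lim gt c \<alpha> by (intro I[of "\<lambda>t. t" "\<lambda>t. c"]) (auto simp: tableau_prob_def intro: Lim)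
  next
    assume "\<alpha> \<noteq> top" and \<beta>: "\<beta> = top"
    then obtain c where c: "0 < c" "\<alpha> = ennreal c" "enn2real \<alpha> = c" "enn2real (inverse \<alpha>) = 1 / c"
      using fin assms by blast
    have "\<exists>L. ((\<lambda>t. finite_prob (Suc m) c t S) \<longlongrightarrow> L) at_top" for S
      using c gt lim by (intro tendsto_finite_prob[where a = "1 / c" and b = 0]) auto
    then show ?thesis
      using lim gt c \<beta> by (intro I[of "\<lambda>t. c" "\<lambda>t. t"]) (auto simp: tableau_prob_def intro: Lim)
  next
    assume "\<alpha> \<noteq> top" "\<beta> \<noteq> top"
    then obtain c e where c: "0 < c" "\<alpha> = ennreal c" "enn2real \<alpha> = c" "enn2real (inverse \<alpha>) = 1 / c"
      and e: "0 < e" "\<beta> = ennreal e" "enn2real \<beta> = e" "enn2real (inverse \<beta>) = 1 / e"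
      using fin assms by metis
    then show ?thesis
      by (intro I[of "\<lambda>t. c" "\<lambda>t. e"]) (auto simp: tableau_prob_def)
  qed
qed

text \<open>Removing the first row makes the parameters positive, so that infinite parameters need no special
  treatment from here on.\<close>

lemma sum_tableau_prob_drop_row:
  fixes g :: "tableau \<Rightarrow> 'c::real_normed_vector"
  assumes "0 < \<alpha>" "0 < \<beta>"
  shows "(\<Sum>S\<in>staircase_tableaux (Suc m). tableau_prob (Suc m) \<alpha> \<beta> S *\<^sub>R g (drop_row S)) =
    expect m (enn2real (inverse \<alpha>) + 1) (enn2real (inverse \<beta>)) g"
proof -
  obtain u v where uv: "\<forall>\<^sub>F t in at_top. 0 < u t \<and> 0 < v t"
    "((\<lambda>t. 1 / u t) \<longlongrightarrow> enn2real (inverse \<alpha>)) at_top" "((\<lambda>t. 1 / v t) \<longlongrightarrow> enn2real (inverse \<beta>)) at_top"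
    and prob: "\<And>S. ((\<lambda>t::real. finite_prob (Suc m) (u t) (v t) S) \<longlongrightarrow> tableau_prob (Suc m) \<alpha> \<beta> S) at_top"
    using tableau_prob_limit[OF assms, of m] by blast
  have "((\<lambda>t. expect m (1 / u t + 1) (1 / v t) g) \<longlongrightarrow>
      expect m (enn2real (inverse \<alpha>) + 1) (enn2real (inverse \<beta>)) g) at_top"
    unfolding expect_def weighted_sum_def
  proof (intro tendsto_scaleR tendsto_inverse tendsto_sum tendsto_dual_weight tendsto_pochhammer tendsto_add tendsto_const uv)
    have "0 < pochhammer (enn2real (inverse \<alpha>) + 1 + enn2real (inverse \<beta>)) m"
      using enn2real_nonneg[of "inverse \<alpha>"] enn2real_nonneg[of "inverse \<beta>"]
      by (intro pochhammer_pos) linarith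
    then show "pochhammer (enn2real (inverse \<alpha>) + 1 + enn2real (inverse \<beta>)) m \<noteq> 0" by simp
  qed
  moreover have "\<forall>\<^sub>F t in at_top. expect m (1 / u t + 1) (1 / v t) g =
      (\<Sum>S\<in>staircase_tableaux (Suc m). finite_prob (Suc m) (u t) (v t) S *\<^sub>R g (drop_row S))"
    using uv(1)
  proof eventually_elim
    case (elim t)
    have "expect m (1 / u t + 1) (1 / v t) g = expect (Suc m) (1 / u t) (1 / v t) (\<lambda>S. g (drop_row S))"
      using elim by (intro expect_drop_row[symmetric]) (auto intro: add_pos_pos)
    also have "\<dots> = (\<Sum>S\<in>staircase_tableaux (Suc m). finite_prob (Suc m) (u t) (v t) S *\<^sub>R g (drop_row S))"
      unfolding expect_def weighted_sum_def scaleR_sum_right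
      using elim by (intro sum.cong refl) (simp add: finite_prob_eq_dual_weight divide_inverse mult.commute)
    finally show ?case .
  qed
  ultimately have lim: "((\<lambda>t. \<Sum>S\<in>staircase_tableaux (Suc m). finite_prob (Suc m) (u t) (v t) S *\<^sub>R g (drop_row S)) \<longlongrightarrow>
      expect m (enn2real (inverse \<alpha>) + 1) (enn2real (inverse \<beta>)) g) at_top"
    by (rule Lim_transform_eventually)
  have "((\<lambda>t. \<Sum>S\<in>staircase_tableaux (Suc m). finite_prob (Suc m) (u t) (v t) S *\<^sub>R g (drop_row S)) \<longlongrightarrow>
      (\<Sum>S\<in>staircase_tableaux (Suc m). tableau_prob (Suc m) \<alpha> \<beta> S *\<^sub>R g (drop_row S))) at_top"
    by (intro tendsto_sum tendsto_scaleR tendsto_const prob)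
  then show ?thesis by (rule tendsto_unique[OF trivial_limit_at_top_linorder _ lim])
qed

text \<open>\<open>embed_pmf\<close> is meaningful only for nonnegative values of total mass 1.
  Nonnegativity and the support pass to the limit, and the mass comes from
  \<open>sum_tableau_prob_drop_row\<close> for the constant function 1.\<close>

lemma pmf_tableau_pmf:
  assumes "0 < \<alpha>" "0 < \<beta>"
  shows "pmf (tableau_pmf (Suc m) \<alpha> \<beta>) S = tableau_prob (Suc m) \<alpha> \<beta> S"
    and "S \<notin> staircase_tableaux (Suc m) \<Longrightarrow> tableau_prob (Suc m) \<alpha> \<beta> S = 0"
proof -
  let ?p = "tableau_prob (Suc m) \<alpha> \<beta>"
  obtain u v where uv: "\<forall>\<^sub>F t in at_top. 0 < u t \<and> 0 < v t"
    and "((\<lambda>t. 1 / u t) \<longlongrightarrow> enn2real (inverse \<alpha>)) at_top" "((\<lambda>t. 1 / v t) \<longlongrightarrow> enn2real (inverse \<beta>)) at_top"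
    and prob: "\<And>S. ((\<lambda>t::real. finite_prob (Suc m) (u t) (v t) S) \<longlongrightarrow> ?p S) at_top"
    using tableau_prob_limit[OF assms, of m] by blast
  have nonneg: "0 \<le> ?p S" for S
  proof (rule tendsto_lowerbound[OF prob])
    show "\<forall>\<^sub>F t in at_top. 0 \<le> finite_prob (Suc m) (u t) (v t) S"
      using uv
    proof eventually_elim
      case (elim t)
      then show ?case
        using partition_function_pos[of "u t" "v t" "Suc m"] by (auto simp: finite_prob_def weight_def)
    qed
  qed simp
  show zero: "?p S = 0" if "S \<notin> staircase_tableaux (Suc m)" for S
  proof (rule tendsto_unique[OF _ prob])
    show "((\<lambda>t. finite_prob (Suc m) (u t) (v t) S) \<longlongrightarrow> 0) at_top"
      using that by (simp add: finite_prob_def)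
  qed simp
  have "(\<integral>\<^sup>+ S. ennreal (?p S) \<partial>count_space UNIV) = (\<Sum>S\<in>staircase_tableaux (Suc m). ennreal (?p S))"
    using zero by (intro nn_integral_count_space') (auto simp: finite_staircase_tableaux)
  also have "\<dots> = ennreal (\<Sum>S\<in>staircase_tableaux (Suc m). ?p S)"
    using nonneg by (simp add: sum_ennreal)
  also have "(\<Sum>S\<in>staircase_tableaux (Suc m). ?p S) = 1"
  proof -
    have "expect m (enn2real (inverse \<alpha>) + 1) (enn2real (inverse \<beta>)) (\<lambda>_. 1 :: real) = 1"
      using enn2real_nonneg[of "inverse \<alpha>"] enn2real_nonneg[of "inverse \<beta>"]
      by (intro expect_const) linarith+
    then show ?thesis using sum_tableau_prob_drop_row[OF assms, of m "\<lambda>_. 1 :: real"] by simp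
  qed
  finally show "pmf (tableau_pmf (Suc m) \<alpha> \<beta>) S = ?p S"
    using nonneg by (simp add: tableau_pmf_def pmf_embed_pmf)
qed

lemma expectation_tableau_pmf:
  fixes f :: "tableau \<Rightarrow> complex"
  assumes "0 < \<alpha>" "0 < \<beta>"
  shows "measure_pmf.expectation (tableau_pmf (Suc m) \<alpha> \<beta>) f =
    (\<Sum>S\<in>staircase_tableaux (Suc m). tableau_prob (Suc m) \<alpha> \<beta> S *\<^sub>R f S)"
  using pmf_tableau_pmf[OF assms]
  by (subst integral_measure_pmf[OF finite_staircase_tableaux[of "Suc m"]]) (auto simp: set_pmf_iff)

text \<open>If the removed row changes the count, it has a \<open>Beta\<close> in column
  \<open>m + 1\<close>. Then no \<open>Alpha\<close> lies below, so the box of that column on the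
  first diagonal is \<open>Beta\<close>, an event of the remaining tableau with small probability.
  This needs no lower bound on the parameter before the removal.\<close>

lemma norm_expectation_sub_beta_pgf:
  assumes pos: "0 < \<alpha>" "0 < \<beta>" and x: "norm x \<le> 1"
  defines "a \<equiv> enn2real (inverse \<alpha>) + 1" and "b \<equiv> enn2real (inverse \<beta>)"
  shows "norm (measure_pmf.expectation (tableau_pmf (Suc (m + q + 1)) \<alpha> \<beta>) (\<lambda>S. x ^ beta_count (Suc (m + q + 1)) (q + 2) S)
    - beta_pgf (q + 2) x b (m + q + 1) a) \<le> 2 * ((a + q) / (a + b + m + q))"
proof -
  let ?N = "m + q + 1" and ?k = "q + 2"
  let ?p = "tableau_prob (Suc ?N) \<alpha> \<beta>"
  let ?D = "\<lambda>T :: tableau. T (q + 1, m + 1) = Some Beta"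
  have ab: "0 \<le> a" "0 \<le> b" "0 < a + b"
    using enn2real_nonneg[of "inverse \<alpha>"] enn2real_nonneg[of "inverse \<beta>"] unfolding a_def b_def by linarith+
  have eq: "measure_pmf.expectation (tableau_pmf (Suc ?N) \<alpha> \<beta>) (\<lambda>S. x ^ beta_count (Suc ?N) ?k S) - beta_pgf ?k x b ?N a
      = (\<Sum>S\<in>staircase_tableaux (Suc ?N). ?p S *\<^sub>R (x ^ beta_count (Suc ?N) ?k S - x ^ beta_count ?N ?k (drop_row S)))"
    unfolding expectation_tableau_pmf[OF pos] beta_pgf_def a_def b_def
      sum_tableau_prob_drop_row[OF pos, of ?N "\<lambda>T. x ^ beta_count ?N ?k T", symmetric]
    by (simp add: scaleR_diff_right sum_subtractf)
  have "norm (\<Sum>S\<in>staircase_tableaux (Suc ?N). ?p S *\<^sub>R (x ^ beta_count (Suc ?N) ?k S - x ^ beta_count ?N ?k (drop_row S)))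
      \<le> (\<Sum>S\<in>staircase_tableaux (Suc ?N). ?p S *\<^sub>R (2 * of_bool (?D (drop_row S))))"
  proof (rule order_trans[OF norm_sum], rule sum_mono)
    fix S assume S: "S \<in> staircase_tableaux (Suc ?N)"
    have p: "0 \<le> ?p S" using pmf_tableau_pmf(1)[OF pos, of ?N S] pmf_nonneg by metis
    have "?D (drop_row S)" if B: "beta_count (Suc ?N) ?k S \<noteq> beta_count ?N ?k (drop_row S)"
    proof -
      have "S (1, m + 1) = Some Beta"
        using B beta_count_drop_row[OF S, of ?k] by (auto split: if_splits)
      then have "S (q + 2, m + 1) \<noteq> Some Alpha"
        using staircase_alpha[OF S, of "q + 2" "m + 1" 1] by auto
      moreover have "S (q + 2, m + 1) \<noteq> None" using S by (rule staircase_diagonal) auto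
      ultimately have "S (q + 2, m + 1) = Some Beta" by (metis option.exhaust symbol.exhaust)
      then show ?thesis by (simp add: drop_row_def)
    qed
    then have "norm (x ^ beta_count (Suc ?N) ?k S - x ^ beta_count ?N ?k (drop_row S)) \<le> 2 * of_bool (?D (drop_row S))"
      using norm_power_diff_le[OF x, of "beta_count (Suc ?N) ?k S" "beta_count ?N ?k (drop_row S)"]
      by (cases "beta_count (Suc ?N) ?k S = beta_count ?N ?k (drop_row S)") auto
    then show "norm (?p S *\<^sub>R (x ^ beta_count (Suc ?N) ?k S - x ^ beta_count ?N ?k (drop_row S)))
        \<le> ?p S *\<^sub>R (2 * of_bool (?D (drop_row S)))"
      using p by (simp add: mult_left_mono)
  qed
  moreover have "(\<Sum>S\<in>staircase_tableaux (Suc ?N). ?p S *\<^sub>R (2 * of_bool (?D (drop_row S)))) =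
      2 * expect ?N a b (\<lambda>T. of_bool (?D T) :: real)"
    using sum_tableau_prob_drop_row[OF pos, of ?N "\<lambda>T. 2 * of_bool (?D T) :: real"]
    unfolding expect_cmult a_def b_def .
  moreover have "expect ?N a b (\<lambda>T. of_bool (?D T) :: real) = (a + q) / (a + b + m + q)"
    using expect_beta_box[OF ab, of m q "\<lambda>_. 1 :: real"] ab by (simp add: expect_const)
  ultimately show ?thesis unfolding eq by (simp only:)
qed

lemma expectation_tableau_pmf_tendsto:
  fixes x :: complex
  assumes pos: "0 < \<alpha>" "0 < \<beta>" and x: "norm x \<le> 1" and k: "1 < k"
  shows "(\<lambda>n. measure_pmf.expectation (tableau_pmf n \<alpha> \<beta>) (\<lambda>S. x ^ beta_count n k S)) \<longlonglongrightarrow> exp ((x - 1) / 2)"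
proof -
  obtain q where q: "k = q + 2" using k by (metis Suc_1 Suc_leI le_iff_add add.commute)
  define a where "a = enn2real (inverse \<alpha>) + 1"
  define b where "b = enn2real (inverse \<beta>)"
  have ab: "1 \<le> a" "0 \<le> b" by (simp_all add: a_def b_def)
  let ?f = "\<lambda>m. measure_pmf.expectation (tableau_pmf (Suc (m + q + 1)) \<alpha> \<beta>) (\<lambda>S. x ^ beta_count (Suc (m + q + 1)) k S)"
  let ?g = "\<lambda>m. beta_pgf k x b (m + q + 1) a"
  have "(\<lambda>m. beta_pgf k x b (m + (q + 1)) a) \<longlonglongrightarrow> exp ((x - 1) / 2)"
    using k by (intro LIMSEQ_ignore_initial_segment beta_pgf_tendsto[OF x _ ab(2,1)]) simp
  then have g: "?g \<longlonglongrightarrow> exp ((x - 1) / 2)" by (simp add: add.assoc)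
  have "(\<lambda>m. ?f m - ?g m) \<longlonglongrightarrow> 0"
  proof (rule Lim_null_comparison[OF always_eventually])
    show "\<forall>m. norm (?f m - ?g m) \<le> 2 * ((a + q) / (a + b + m + q))"
      using norm_expectation_sub_beta_pgf[OF pos x] unfolding q a_def b_def by blast
    show "(\<lambda>m. 2 * ((a + q) / (a + b + real m + q))) \<longlonglongrightarrow> 0" by real_asymp
  qed
  from tendsto_add[OF this g] have "?f \<longlonglongrightarrow> exp ((x - 1) / 2)" by simp
  then have "(\<lambda>m. (\<lambda>n. measure_pmf.expectation (tableau_pmf n \<alpha> \<beta>) (\<lambda>S. x ^ beta_count n k S)) (m + (q + 2)))
      \<longlonglongrightarrow> exp ((x - 1) / 2)" by simp
  then show ?thesis by (rule LIMSEQ_offset)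
qed

section \<open>Characteristic functions and the Poisson limit\<close>

lemma char_distr_measure_pmf:
  "char (distr (measure_pmf p) borel (\<lambda>S. real (X S))) t =
    measure_pmf.expectation p (\<lambda>S. iexp t ^ X S)"
proof -
  have "iexp (t * real m) = iexp t ^ m" for m
    by (simp add: exp_of_nat_mult[symmetric] mult_ac)
  then show ?thesis by (simp add: char_def integral_distr)
qed

lemma expectation_poisson_pmf:
  fixes x :: complex
  assumes r: "0 < r" and x: "norm x \<le> 1"
  shows "measure_pmf.expectation (poisson_pmf r) (\<lambda>m. x ^ m) = exp (r * (x - 1))"
proof -
  have "integrable (measure_pmf (poisson_pmf r)) (\<lambda>m. x ^ m)"
    using x by (intro measure_pmf.integrable_const_bound[where B = 1]) (auto simp: norm_power power_le_one)
  then have int: "integrable (count_space UNIV) (\<lambda>m. pmf (poisson_pmf r) m *\<^sub>R x ^ m)"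
    unfolding measure_pmf_eq_density by (subst (asm) integrable_density) auto
  have "measure_pmf.expectation (poisson_pmf r) (\<lambda>m. x ^ m) =
      integral\<^sup>L (count_space UNIV) (\<lambda>m. pmf (poisson_pmf r) m *\<^sub>R x ^ m)"
    unfolding measure_pmf_eq_density by (subst integral_density) auto
  then have "(\<lambda>m. pmf (poisson_pmf r) m *\<^sub>R x ^ m) sums measure_pmf.expectation (poisson_pmf r) (\<lambda>m. x ^ m)"
    using sums_integral_count_space_nat[OF int] by simp
  moreover have "(\<lambda>m. pmf (poisson_pmf r) m *\<^sub>R x ^ m) sums (exp (- r) *\<^sub>R exp (r *\<^sub>R x))"
  proof -
    have "pmf (poisson_pmf r) m *\<^sub>R x ^ m = exp (- r) *\<^sub>R ((r *\<^sub>R x) ^ m /\<^sub>R fact m)" for m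
      using r by (simp add: scaleR_power divide_inverse mult_ac)
    then show ?thesis by (simp only:) (rule sums_scaleR_right[OF exp_converges])
  qed
  ultimately have "measure_pmf.expectation (poisson_pmf r) (\<lambda>m. x ^ m) = exp (- r) *\<^sub>R exp (r *\<^sub>R x)"
    by (rule sums_unique2)
  also have "\<dots> = exp (r * (x - 1))"
    by (simp add: scaleR_conv_of_real exp_of_real[symmetric] exp_add[symmetric] algebra_simps)
  finally show ?thesis .
qed

theorem corollary6:
  fixes \<alpha> \<beta> :: ennreal and k :: nat
  assumes "k > 1" and "\<alpha> > 0" and "\<beta> > 0"
  shows "weak_conv_m
           (\<lambda>n. distr (measure_pmf (tableau_pmf n \<alpha> \<beta>)) borel (\<lambda>S. real (beta_count n k S)))
           (distr (measure_pmf (poisson_pmf (1/2))) borel real)"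
proof (rule levy_continuity)
  fix t
  have "(\<lambda>n. measure_pmf.expectation (tableau_pmf n \<alpha> \<beta>) (\<lambda>S. iexp t ^ beta_count n k S)) \<longlonglongrightarrow> exp ((iexp t - 1) / 2)"
    using assms by (intro expectation_tableau_pmf_tendsto) auto
  moreover have "char (distr (measure_pmf (poisson_pmf (1/2))) borel real) t = exp ((iexp t - 1) / 2)"
    using char_distr_measure_pmf[of "poisson_pmf (1/2)" "\<lambda>m. m" t] expectation_poisson_pmf[of "1/2" "iexp t"] by simp
  ultimately show "(\<lambda>n. char (distr (measure_pmf (tableau_pmf n \<alpha> \<beta>)) borel (\<lambda>S. real (beta_count n k S))) t)
      \<longlonglongrightarrow> char (distr (measure_pmf (poisson_pmf (1/2))) borel real) t"
    by (simp only: char_distr_measure_pmf)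
qed (auto intro: prob_space.real_distribution_distr[OF measure_pmf.prob_space_axioms])

end
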